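(* Consider the finite-sum problem $\min_{x\in\mathbb{R}^d} f(x)$, $f=\frac1n\sum_{i=1}^n f_i$, and suppose that Assumptions (A1)--(A5) of the context hold. Run the momentum algorithm described in the context with either (i) epochwise-restart momentum (SpiderSQNMER): $\alpha_k=\frac{2}{\operatorname{mod}(k,q)+1}$, or (ii) epochwise-diminishing momentum (SpiderSQNMED): $\alpha_k=\frac{2}{\lceil k/q\rceil+1}$, and with $q=|\xi_k|\equiv\sqrt n$, $$\beta_k\equiv\frac{\sigma_{\min}}{(3+\sqrt{15})\,L\,\sigma_{\max}^2},\qquad \lambda_k\in[\beta_k,(1+\alpha_k)\beta_k],$$ and let $z_\zeta$ be its output. Then, for both algorithms and any $\epsilon>0$, the output satisfies $\mathbb{E}\|\nabla f(z_\zeta)\|\le\epsilon$ provided that the number of iterations $K$ satisfies $$K\ge \mathcal{O}\Big(\frac{f(x_0)-f^*}{\epsilon^2}\Big).$$ Moreover, the total number of SFO calls (needed to achieve this) is at most in the order of $\mathcal{O}(n+n^{1/2}\epsilon^{-2})$.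
   Context: Norms are Euclidean for vectors and spectral for matrices; $A\preceq B$ means that $B-A$ is positive semidefinite; $\operatorname{mod}(k,q)$ is the remainder of $k$ modulo $q$. Assumptions. (A1) $f^*:=\inf_{x\in\mathbb{R}^d} f(x)>-\infty$. (A2) Each $f_i:\mathbb{R}^d\to\mathbb{R}$ is $L$-smooth with $L>0$: $\|\nabla f_i(x)-\nabla f_i(y)\|\le L\|x-y\|$ for all $x,y$. (A3) Each $f_i$ is twice continuously differentiable and there is $\kappa>0$ with $\|\nabla^2 f_i(x)\|\le\kappa$ for all $x$ and $i$. (A4) There are constants $\sigma_{\min},\sigma_{\max}>0$ with $\sigma_{\min}I\preceq H_k\preceq\sigma_{\max}I$ for all $k$, where $H_k$ is the inverse Hessian approximation matrix used at iteration $k$. (A5) For $k\ge2$, $H_k$ depends only on $v_{k-1}$ and $\xi_k$, and $\mathbb{E}[H_kv_k\mid \xi_k,v_{k-1}]=H_kv_k$. Momentum algorithm. Start at $y_0=x_0\in\mathbb{R}^d$. For $k=0,\dots,K-1$: set $z_k=(1-\alpha_{k+1})y_k+\alpha_{k+1}x_k$; if $k\equiv0\pmod q$, set $v_k=\nabla f(z_k)$; otherwise draw a mini-batch $\xi_k$ of $|\xi_k|$ indices uniformly at random with replacement from $\{1,\dots,n\}$ and set $v_k=\nabla f_{\xi_k}(z_k)-\nabla f_{\xi_k}(z_{k-1})+v_{k-1}$, where $\nabla f_{\xi_k}(x)=\frac1{|\xi_k|}\sum_{i\in\xi_k}\nabla f_i(x)$. Compute $d_k=H_kv_k$ by SdLBFGS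 (below) and set $x_{k+1}=x_k-\lambda_kd_k$, $y_{k+1}=z_k-\beta_kd_k$. The output is $z_\zeta$ with $\zeta$ uniformly distributed on $\{0,\dots,K-1\}$. SdLBFGS (stochastic damped L-BFGS, memory size $m$, constant $\delta>0$). For $k\ge1$ put $s_{k-1}=x_k-x_{k-1}$, $\bar y_{k-1}=v_k-v_{k-1}$, $\gamma_k=\max\{\bar y_{k-1}^\top\bar y_{k-1}/(s_{k-1}^\top\bar y_{k-1}),\delta\}$, $H_{k,0}=\gamma_k^{-1}I$, $\sigma_{k-1}=s_{k-1}^\top H_{k,0}^{-1}s_{k-1}$, $\theta_{k-1}=\frac{0.75\sigma_{k-1}}{\sigma_{k-1}-s_{k-1}^\top\bar y_{k-1}}$ if $s_{k-1}^\top\bar y_{k-1}<0.25\sigma_{k-1}$ and $\theta_{k-1}=1$ otherwise, $\hat y_{k-1}=\theta_{k-1}\bar y_{k-1}+(1-\theta_{k-1})H_{k,0}^{-1}s_{k-1}$, $\rho_{k-1}=(s_{k-1}^\top\hat y_{k-1})^{-1}$. Starting from $H_{k,0}$, $H_k$ is obtained by applying, successively for the (at most $m$) most recent indices $j=k-m,\dots,k-1$ with $j\ge0$, the update $H\mapsto (I-\rho_js_j\hat y_j^\top)H(I-\rho_j\hat y_js_j^\top)+\rho_js_js_j^\top$. For $k=0$ there are no pairs and $H_0=H_{0,0}=\gamma_0^{-1}I$. An SFO (stochastic first-order oracle) call takes a sample index $i$ and a point $x$ and returns $(f_i(x),\nabla f_i(x))$; a full gradient costs $n$ calls. Integer rounding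 of $\sqrt n$ is suppressed. "$K\ge\mathcal{O}(A)$" means: there is a constant $C>0$ depending only on $L,\sigma_{\min},\sigma_{\max}$ such that $K\ge CA$ suffices. The SFO count refers to $K$ taken of this order; the hidden constant may depend on $L,\sigma_{\min},\sigma_{\max}$ and $f(x_0)-f^*$, but not on $n$ or $\epsilon$.
   Formalization: For epochwise restart (SpiderSQNMER) the formal statement requires q ≥ 2: when q = 1 (n = 1, or √n rounded down for n = 2, 3) one has α_k = 2 for all k and the iterates can diverge, so the claim fails; SpiderSQNMED is covered for every n ≥ 1. *)

theory Defs
  imports "HOL-Probability.Probability" "Jordan_Normal_Form.Matrix"
begin

text \<open>
  The dimension \<open>d\<close> is quantified inside the theorem, after the constant that must not depend on
  it. Vectors and matrices are therefore those of \<open>Jordan_Normal_Form\<close>, with \<open>carrier_vec d\<close> in the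
  role of \<open>d\<close>-dimensional real space; functions are only ever considered on this carrier.
\<close>

section \<open>Euclidean and spectral norm, Loewner order\<close>

definition vnorm :: "real vec \<Rightarrow> real" where
  "vnorm u = sqrt (u \<bullet> u)"

definition spectral_norm :: "nat \<Rightarrow> real mat \<Rightarrow> real" where
  "spectral_norm d A = (SUP u \<in> {u \<in> carrier_vec d. vnorm u \<le> 1}. vnorm (A *\<^sub>v u))"

definition psd :: "nat \<Rightarrow> real mat \<Rightarrow> bool" where
  "psd d A \<longleftrightarrow> A \<in> carrier_mat d d \<and> A\<^sup>T = A \<and> (\<forall>u\<in>carrier_vec d. 0 \<le> u \<bullet> (A *\<^sub>v u))"

definition loewner_le :: "nat \<Rightarrow> real mat \<Rightarrow> real mat \<Rightarrow> bool" where
  "loewner_le d A B \<longleftrightarrow> A \<in> carrier_mat d d \<and> B \<in> carrier_mat d d \<and> psd d (B - A)"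

section \<open>Gradient and Hessian (Frechet)\<close>

definition has_gradient ::
    "nat \<Rightarrow> (real vec \<Rightarrow> real) \<Rightarrow> real vec \<Rightarrow> real vec \<Rightarrow> bool" where
  "has_gradient d f g x \<longleftrightarrow> g \<in> carrier_vec d \<and>
     (\<forall>e>0. \<exists>r>0. \<forall>h\<in>carrier_vec d. vnorm h < r \<longrightarrow> \<bar>f (x + h) - f x - g \<bullet> h\<bar> \<le> e * vnorm h)"

definition grad :: "nat \<Rightarrow> (real vec \<Rightarrow> real) \<Rightarrow> real vec \<Rightarrow> real vec" where
  "grad d f x = (SOME g. has_gradient d f g x)"

definition differentiable_everywhere :: "nat \<Rightarrow> (real vec \<Rightarrow> real) \<Rightarrow> bool" where
  "differentiable_everywhere d f \<longleftrightarrow> (\<forall>x\<in>carrier_vec d. \<exists>g. has_gradient d f g x)"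

definition has_hessian ::
    "nat \<Rightarrow> (real vec \<Rightarrow> real) \<Rightarrow> real mat \<Rightarrow> real vec \<Rightarrow> bool" where
  "has_hessian d f A x \<longleftrightarrow> A \<in> carrier_mat d d \<and>
     (\<forall>e>0. \<exists>r>0. \<forall>h\<in>carrier_vec d. vnorm h < r \<longrightarrow>
        vnorm (grad d f (x + h) - grad d f x - A *\<^sub>v h) \<le> e * vnorm h)"

definition hessian :: "nat \<Rightarrow> (real vec \<Rightarrow> real) \<Rightarrow> real vec \<Rightarrow> real mat" where
  "hessian d f x = (SOME A. has_hessian d f A x)"

definition twice_continuously_differentiable :: "nat \<Rightarrow> (real vec \<Rightarrow> real) \<Rightarrow> bool" where
  "twice_continuously_differentiable d f \<longleftrightarrow>
     differentiable_everywhere d f \<and>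
     (\<forall>x\<in>carrier_vec d. \<exists>A. has_hessian d f A x) \<and>
     (\<forall>x\<in>carrier_vec d. \<forall>e>0. \<exists>r>0. \<forall>h\<in>carrier_vec d. vnorm h < r \<longrightarrow>
        spectral_norm d (hessian d f (x + h) - hessian d f x) < e)"

definition smooth :: "nat \<Rightarrow> real \<Rightarrow> (real vec \<Rightarrow> real) \<Rightarrow> bool" where
  "smooth d L f \<longleftrightarrow> differentiable_everywhere d f \<and>
     (\<forall>x\<in>carrier_vec d. \<forall>y\<in>carrier_vec d.
        vnorm (grad d f x - grad d f y) \<le> L * vnorm (x - y))"

section \<open>Finite-sum objective and mini-batch gradients\<close>

definition objective :: "nat \<Rightarrow> (nat \<Rightarrow> real vec \<Rightarrow> real) \<Rightarrow> real vec \<Rightarrow> real" where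
  "objective n F x = (\<Sum>i=1..n. F i x) / real n"

definition optimal_value :: "nat \<Rightarrow> (real vec \<Rightarrow> real) \<Rightarrow> real" where
  "optimal_value d f = (INF x \<in> carrier_vec d. f x)"

text \<open>A mini-batch is a list of indices, since sampling with replacement may repeat an index.\<close>

definition batch_grad ::
    "nat \<Rightarrow> (nat \<Rightarrow> real vec \<Rightarrow> real) \<Rightarrow> nat list \<Rightarrow> real vec \<Rightarrow> real vec" where
  "batch_grad d F I x = vec d (\<lambda>j. (\<Sum>i\<leftarrow>I. grad d (F i) x $ j) / real (length I))"

section \<open>SdLBFGS\<close>

text \<open>
  Below, \<open>x\<close> and \<open>v\<close> are the sequences of iterates and gradient estimates. The initial matrix at
  step \<open>k\<close> is \<open>H\<^sub>k\<^sub>,\<^sub>0 = (1 / \<gamma>\<^sub>k) I\<close>, hence its inverse acts as multiplication by \<open>\<gamma>\<^sub>k\<close>; the pair with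
  index \<open>j\<close> is formed at step \<open>j + 1\<close> and uses \<open>\<gamma>\<close> of that step. There is no pair at step 0, so
  \<open>\<gamma>\<^sub>0\<close> is a parameter. Divisions by zero (possible only if consecutive iterates or estimates
  degenerate) follow the convention \<open>a / 0 = 0\<close>.
\<close>

definition outer :: "real vec \<Rightarrow> real vec \<Rightarrow> real mat" where
  "outer u w = mat (dim_vec u) (dim_vec w) (\<lambda>(i, j). u $ i * w $ j)"

definition sdiff :: "(nat \<Rightarrow> real vec) \<Rightarrow> nat \<Rightarrow> real vec" where
  "sdiff x j = x (j + 1) - x j"

definition ybar :: "(nat \<Rightarrow> real vec) \<Rightarrow> nat \<Rightarrow> real vec" where
  "ybar v j = v (j + 1) - v j"

definition gam ::
    "real \<Rightarrow> real \<Rightarrow> (nat \<Rightarrow> real vec) \<Rightarrow> (nat \<Rightarrow> real vec) \<Rightarrow> nat \<Rightarrow> real" where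
  "gam \<delta> \<gamma>0 x v k = (if k = 0 then \<gamma>0
     else max ((ybar v (k - 1) \<bullet> ybar v (k - 1)) / (sdiff x (k - 1) \<bullet> ybar v (k - 1))) \<delta>)"

definition sig ::
    "real \<Rightarrow> real \<Rightarrow> (nat \<Rightarrow> real vec) \<Rightarrow> (nat \<Rightarrow> real vec) \<Rightarrow> nat \<Rightarrow> real" where
  "sig \<delta> \<gamma>0 x v j = sdiff x j \<bullet> (gam \<delta> \<gamma>0 x v (j + 1) \<cdot>\<^sub>v sdiff x j)"

definition theta ::
    "real \<Rightarrow> real \<Rightarrow> (nat \<Rightarrow> real vec) \<Rightarrow> (nat \<Rightarrow> real vec) \<Rightarrow> nat \<Rightarrow> real" where
  "theta \<delta> \<gamma>0 x v j =
     (if sdiff x j \<bullet> ybar v j < 0.25 * sig \<delta> \<gamma>0 x v j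
      then 0.75 * sig \<delta> \<gamma>0 x v j / (sig \<delta> \<gamma>0 x v j - sdiff x j \<bullet> ybar v j)
      else 1)"

definition yhat ::
    "real \<Rightarrow> real \<Rightarrow> (nat \<Rightarrow> real vec) \<Rightarrow> (nat \<Rightarrow> real vec) \<Rightarrow> nat \<Rightarrow> real vec" where
  "yhat \<delta> \<gamma>0 x v j = theta \<delta> \<gamma>0 x v j \<cdot>\<^sub>v ybar v j
     + (1 - theta \<delta> \<gamma>0 x v j) \<cdot>\<^sub>v (gam \<delta> \<gamma>0 x v (j + 1) \<cdot>\<^sub>v sdiff x j)"

definition rho ::
    "real \<Rightarrow> real \<Rightarrow> (nat \<Rightarrow> real vec) \<Rightarrow> (nat \<Rightarrow> real vec) \<Rightarrow> nat \<Rightarrow> real" where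
  "rho \<delta> \<gamma>0 x v j = 1 / (sdiff x j \<bullet> yhat \<delta> \<gamma>0 x v j)"

definition bfgs_update :: "nat \<Rightarrow> real \<Rightarrow> real vec \<Rightarrow> real vec \<Rightarrow> real mat \<Rightarrow> real mat" where
  "bfgs_update d r s y H =
     (1\<^sub>m d - r \<cdot>\<^sub>m outer s y) * H * (1\<^sub>m d - r \<cdot>\<^sub>m outer y s) + r \<cdot>\<^sub>m outer s s"

text \<open>Truncated subtraction makes \<open>[k - m..<k]\<close> the at most \<open>m\<close> most recent indices, oldest first.\<close>

definition sdlbfgs ::
    "nat \<Rightarrow> nat \<Rightarrow> real \<Rightarrow> real \<Rightarrow> (nat \<Rightarrow> real vec) \<Rightarrow> (nat \<Rightarrow> real vec) \<Rightarrow> nat \<Rightarrow> real mat" where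
  "sdlbfgs d m \<delta> \<gamma>0 x v k =
     fold (\<lambda>j. bfgs_update d (rho \<delta> \<gamma>0 x v j) (sdiff x j) (yhat \<delta> \<gamma>0 x v j))
       [k - m..<k] ((1 / gam \<delta> \<gamma>0 x v k) \<cdot>\<^sub>m 1\<^sub>m d)"

section \<open>Momentum algorithm\<close>

definition alpha_MER :: "nat \<Rightarrow> nat \<Rightarrow> real" where
  "alpha_MER q k = 2 / (real (k mod q) + 1)"

definition alpha_MED :: "nat \<Rightarrow> nat \<Rightarrow> real" where
  "alpha_MED q k = 2 / (of_int \<lceil>real k / real q\<rceil> + 1)"

text \<open>
  \<open>momentum_run\<close> says that \<open>x, y, z, v\<close> are the trajectories of the algorithm for one outcome \<open>\<xi>\<close> of
  the mini-batches. The equations determine \<open>x, y\<close> up to index \<open>K\<close> and \<open>z, v\<close> below \<open>K\<close> recursively,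
  because \<open>sdlbfgs \<dots> k\<close> only reads \<open>x\<close> and \<open>v\<close> up to index \<open>k\<close>.
\<close>

definition momentum_run ::
    "nat \<Rightarrow> nat \<Rightarrow> (nat \<Rightarrow> real vec \<Rightarrow> real) \<Rightarrow> nat \<Rightarrow> nat \<Rightarrow> real \<Rightarrow> real \<Rightarrow>
     (nat \<Rightarrow> real) \<Rightarrow> (nat \<Rightarrow> real) \<Rightarrow> (nat \<Rightarrow> real) \<Rightarrow> real vec \<Rightarrow> nat \<Rightarrow> (nat \<Rightarrow> nat list) \<Rightarrow>
     (nat \<Rightarrow> real vec) \<Rightarrow> (nat \<Rightarrow> real vec) \<Rightarrow> (nat \<Rightarrow> real vec) \<Rightarrow> (nat \<Rightarrow> real vec) \<Rightarrow> bool" where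
  "momentum_run d n F q m \<delta> \<gamma>0 \<alpha> \<beta> lam x0 K \<xi> x y z v \<longleftrightarrow>
     x 0 = x0 \<and> y 0 = x0 \<and>
     (\<forall>k<K.
        z k = (1 - \<alpha> (k + 1)) \<cdot>\<^sub>v y k + \<alpha> (k + 1) \<cdot>\<^sub>v x k \<and>
        v k = (if k mod q = 0 then grad d (objective n F) (z k)
               else batch_grad d F (\<xi> k) (z k) - batch_grad d F (\<xi> k) (z (k - 1)) + v (k - 1)) \<and>
        x (k + 1) = x k - lam k \<cdot>\<^sub>v (sdlbfgs d m \<delta> \<gamma>0 x v k *\<^sub>v v k) \<and>
        y (k + 1) = z k - \<beta> k \<cdot>\<^sub>v (sdlbfgs d m \<delta> \<gamma>0 x v k *\<^sub>v v k))"

text \<open>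
  Joint law of the independent mini-batches: \<open>b\<close> uniform draws with replacement from \<open>{1..n}\<close> at
  every iteration that is not a restart; at a restart nothing is drawn and \<open>\<xi> k = []\<close>.
\<close>

definition batch_law :: "nat \<Rightarrow> nat \<Rightarrow> nat \<Rightarrow> nat \<Rightarrow> (nat \<Rightarrow> nat list) pmf" where
  "batch_law n q b K =
     Pi_pmf {k. k < K \<and> k mod q \<noteq> 0} [] (\<lambda>_. replicate_pmf b (pmf_of_set {1..n}))"

text \<open>
  \<open>H\<^sub>k\<close> is a function of \<open>(v\<^sub>k\<^sub>-\<^sub>1, \<xi>\<^sub>k)\<close>, and the conditional expectation of \<open>H\<^sub>k v\<^sub>k\<close> given these two
  (componentwise) is \<open>H\<^sub>k v\<^sub>k\<close>. The mini-batches take only finitely many values almost surely, so the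
  discrete sigma-algebra is used for the conditioning variables.
\<close>

definition hessian_approx_dependence ::
    "nat \<Rightarrow> nat \<Rightarrow> (nat \<Rightarrow> nat list) pmf \<Rightarrow> ((nat \<Rightarrow> nat list) \<Rightarrow> nat \<Rightarrow> real mat) \<Rightarrow>
     ((nat \<Rightarrow> nat list) \<Rightarrow> nat \<Rightarrow> real vec) \<Rightarrow> bool" where
  "hessian_approx_dependence d K P H v \<longleftrightarrow>
     (\<forall>k. 2 \<le> k \<and> k < K \<longrightarrow>
        (\<exists>\<phi>. \<forall>\<xi>\<in>set_pmf P. H \<xi> k = \<phi> (v \<xi> (k - 1)) (\<xi> k)) \<and>
        (\<forall>i<d. AE \<xi> in measure_pmf P.
           real_cond_exp (measure_pmf P)
             (vimage_algebra UNIV (\<lambda>\<xi>. (\<xi> k, v \<xi> (k - 1))) (count_space UNIV))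
             (\<lambda>\<xi>. (H \<xi> k *\<^sub>v v \<xi> k) $ i) \<xi> = (H \<xi> k *\<^sub>v v \<xi> k) $ i))"

text \<open>
  A restart evaluates all \<open>n\<close> component gradients; any other iteration evaluates those in the
  mini-batch at the two points \<open>z\<^sub>k\<close> and \<open>z\<^sub>k\<^sub>-\<^sub>1\<close>.
\<close>

definition sfo_calls :: "nat \<Rightarrow> nat \<Rightarrow> (nat \<Rightarrow> nat list) \<Rightarrow> nat \<Rightarrow> nat" where
  "sfo_calls n q \<xi> K = (\<Sum>k<K. if k mod q = 0 then n else 2 * length (\<xi> k))"

end

theory Submission
  imports Defs
begin

text \<open>
  Put \<open>u\<^sub>k = y\<^sub>k - x\<^sub>k\<close> and \<open>d\<^sub>k = H\<^sub>k v\<^sub>k\<close>. Then \<open>z\<^sub>k - x\<^sub>k = (1 - \<alpha>\<^sub>k\<^sub>+\<^sub>1) u\<^sub>k\<close> and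
  \<open>u\<^sub>k\<^sub>+\<^sub>1 = (1 - \<alpha>\<^sub>k\<^sub>+\<^sub>1) u\<^sub>k + (\<lambda>\<^sub>k - \<beta>) d\<^sub>k\<close>, so momentum merely perturbs the quasi-Newton descent of
  \<open>f\<close> along \<open>x\<^sub>k\<close> by multiples of \<open>u\<^sub>k\<close>. The descent itself is measured by \<open>\<parallel>d\<^sub>k\<parallel>\<^sup>2\<close>, because
  \<open>\<langle>v\<^sub>k, d\<^sub>k\<rangle> \<ge> \<parallel>d\<^sub>k\<parallel>\<^sup>2 / \<sigma>\<^sub>m\<^sub>a\<^sub>x\<close>. The mean square error of \<open>v\<^sub>k\<close> as an estimate of \<open>\<nabla>f(z\<^sub>k)\<close> vanishes
  at restarts and otherwise grows by at most \<open>L\<^sup>2/q\<close> times the mean of \<open>\<parallel>z\<^sub>k - z\<^sub>k\<^sub>-\<^sub>1\<parallel>\<^sup>2\<close>, where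
  \<open>z\<^sub>k - z\<^sub>k\<^sub>-\<^sub>1 = - \<beta> d\<^sub>k\<^sub>-\<^sub>1 - \<alpha>\<^sub>k\<^sub>+\<^sub>1 u\<^sub>k\<close>. All perturbations are absorbed by the expectation of the potential
  \<open>\<sigma>\<^sub>m\<^sub>a\<^sub>x/\<beta> f(x\<^sub>k) + (L \<sigma>\<^sub>m\<^sub>a\<^sub>x)\<^sup>2 p\<^sub>k \<parallel>u\<^sub>k\<parallel>\<^sup>2 + 11/5 \<sigma>\<^sub>m\<^sub>a\<^sub>x\<^sup>2 (q - k mod q) \<parallel>v\<^sub>k - \<nabla>f(z\<^sub>k)\<parallel>\<^sup>2\<close> with \<open>p\<^sub>k\<close>
  essentially proportional to \<open>1/\<alpha>\<^sub>k\<close>, which decreases by a multiple of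
  \<open>\<parallel>d\<^sub>k\<parallel>\<^sup>2 + \<sigma>\<^sub>m\<^sub>a\<^sub>x\<^sup>2 \<parallel>v\<^sub>k - \<nabla>f(z\<^sub>k)\<parallel>\<^sup>2\<close> per iteration and hence controls \<open>\<parallel>\<nabla>f(z\<^sub>k)\<parallel>\<^sup>2\<close>. With \<open>q\<close> close to
  \<open>sqrt n\<close>, restarts and mini-batches both cost of order \<open>sqrt n\<close> calls per iteration.
\<close>

unbundle no inner_syntax

section \<open>Euclidean geometry of vectors\<close>

lemma vnorm_L2_set: "u \<in> carrier_vec d \<Longrightarrow> vnorm u = L2_set (\<lambda>i. u $ i) {..<d}"
  by (auto simp: vnorm_def L2_set_def scalar_prod_def power2_eq_square lessThan_atLeast0)

lemma scalar_prod_self_nonneg: "0 \<le> u \<bullet> (u :: real vec)"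
  by (auto simp: scalar_prod_def intro!: sum_nonneg)

lemma vnorm_nonneg [simp]: "0 \<le> vnorm u"
  by (simp add: vnorm_def scalar_prod_self_nonneg)

lemma vnorm_power2: "(vnorm u)\<^sup>2 = u \<bullet> u"
  by (simp add: vnorm_def scalar_prod_self_nonneg)

lemma vnorm_power2_sum: "u \<in> carrier_vec d \<Longrightarrow> (vnorm u)\<^sup>2 = (\<Sum>i<d. (u $ i)\<^sup>2)"
  unfolding vnorm_power2 by (simp add: scalar_prod_def power2_eq_square lessThan_atLeast0)

lemma vnorm_zero [simp]: "vnorm (0\<^sub>v d) = 0"
  by (simp add: vnorm_def)

lemma vnorm_smult: "vnorm (c \<cdot>\<^sub>v u) = \<bar>c\<bar> * vnorm u"
  by (simp add: vnorm_def real_sqrt_mult flip: mult.assoc)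

lemma vnorm_triangle:
  assumes "u \<in> carrier_vec d" "w \<in> carrier_vec d"
  shows "vnorm (u + w) \<le> vnorm u + vnorm w"
proof -
  have "vnorm (u + w) = L2_set (\<lambda>i. u $ i + w $ i) {..<d}"
    using assms by (subst vnorm_L2_set[of _ d]) (auto intro!: L2_set_cong)
  also have "\<dots> \<le> vnorm u + vnorm w"
    using assms L2_set_triangle_ineq by (simp add: vnorm_L2_set[of _ d])
  finally show ?thesis .
qed

lemma vnorm_minus_commute:
  assumes "u \<in> carrier_vec d" "w \<in> carrier_vec d"
  shows "vnorm (u - w) = vnorm (w - u)"
proof -
  have "u - w = (-1) \<cdot>\<^sub>v (w - u)"
    using assms by (intro eq_vecI) auto
  thus ?thesis by (simp add: vnorm_smult)
qed

lemma Cauchy_Schwarz_vec: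
  assumes "u \<in> carrier_vec d" "w \<in> carrier_vec d"
  shows "\<bar>u \<bullet> w\<bar> \<le> vnorm u * vnorm w"
proof -
  have "\<bar>u \<bullet> w\<bar> \<le> (\<Sum>i<d. \<bar>u $ i\<bar> * \<bar>w $ i\<bar>)"
    using assms sum_abs[of "\<lambda>i. u $ i * w $ i" "{..<d}"]
    by (simp add: scalar_prod_def lessThan_atLeast0 abs_mult)
  also have "\<dots> \<le> vnorm u * vnorm w"
    using assms L2_set_mult_ineq by (simp add: vnorm_L2_set[of _ d])
  finally show ?thesis .
qed

lemma scalar_prod_le_vnorm:
  assumes "u \<in> carrier_vec d" "w \<in> carrier_vec d"
  shows "u \<bullet> w \<le> vnorm u * vnorm w"
  using Cauchy_Schwarz_vec[OF assms] by linarith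

section \<open>Gradients\<close>

text \<open>Testing both expansions at a short multiple of \<open>g - g'\<close> with tolerance
  \<open>vnorm w / 4\<close> bounds a positive quantity by half of itself. Uniqueness is what lets
  the choice operator in \<open>grad\<close> be evaluated.\<close>

lemma has_gradient_unique:
  assumes g: "has_gradient d f g x" and g': "has_gradient d f g' x"
  shows "g = g'"
proof (rule ccontr)
  assume "g \<noteq> g'"
  have c: "g \<in> carrier_vec d" "g' \<in> carrier_vec d"
    using g g' by (auto simp: has_gradient_def)
  define w where "w = g - g'"
  have w: "w \<in> carrier_vec d" using c by (simp add: w_def)
  have N: "vnorm w > 0"
  proof (rule ccontr)
    assume "\<not> vnorm w > 0"
    hence "(vnorm w)\<^sup>2 = 0" using vnorm_nonneg[of w] by auto
    hence "(\<Sum>i<d. (w $ i)\<^sup>2) = 0" using w by (simp add: vnorm_power2_sum)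
    hence "\<forall>i<d. w $ i = 0" by (simp add: sum_nonneg_eq_0_iff)
    hence "g = g'" using c by (intro eq_vecI) (auto simp: w_def)
    with \<open>g \<noteq> g'\<close> show False by simp
  qed
  define e where "e = vnorm w / 4"
  have "e > 0" using N by (simp add: e_def)
  obtain r where r: "r > 0"
      "\<And>h. h \<in> carrier_vec d \<Longrightarrow> vnorm h < r \<Longrightarrow> \<bar>f (x + h) - f x - g \<bullet> h\<bar> \<le> e * vnorm h"
    using g \<open>e > 0\<close> unfolding has_gradient_def by meson
  obtain r' where r': "r' > 0"
      "\<And>h. h \<in> carrier_vec d \<Longrightarrow> vnorm h < r' \<Longrightarrow> \<bar>f (x + h) - f x - g' \<bullet> h\<bar> \<le> e * vnorm h"
    using g' \<open>e > 0\<close> unfolding has_gradient_def by meson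
  define t where "t = min r r' / (2 * vnorm w)"
  have t: "t > 0" using r r' N by (simp add: t_def)
  define h where "h = t \<cdot>\<^sub>v w"
  have h: "h \<in> carrier_vec d" using w by (simp add: h_def)
  have nh: "vnorm h = t * vnorm w" using t by (simp add: h_def vnorm_smult)
  have "t * vnorm w = min r r' / 2" using N by (simp add: t_def)
  hence "vnorm h < r" "vnorm h < r'" using nh r r' by auto
  hence "\<bar>f (x + h) - f x - g \<bullet> h\<bar> \<le> e * vnorm h" "\<bar>f (x + h) - f x - g' \<bullet> h\<bar> \<le> e * vnorm h"
    using r r' h by auto
  hence "\<bar>g \<bullet> h - g' \<bullet> h\<bar> \<le> 2 * e * vnorm h" by linarith
  moreover have "g \<bullet> h - g' \<bullet> h = t * (vnorm w)\<^sup>2"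
    using c w h minus_scalar_prod_distrib[of g d g' h]
    by (simp add: h_def w_def vnorm_power2)
  ultimately have "t * (vnorm w)\<^sup>2 \<le> t * ((vnorm w)\<^sup>2 / 2)"
    using nh by (simp add: e_def power2_eq_square mult_ac)
  thus False using t N by simp
qed

lemma grad_eqI: "has_gradient d f g x \<Longrightarrow> grad d f x = g"
  unfolding grad_def by (rule some_equality) (auto intro: has_gradient_unique)

lemma differentiable_has_gradient:
  "differentiable_everywhere d f \<Longrightarrow> x \<in> carrier_vec d \<Longrightarrow> has_gradient d f (grad d f x) x"
  unfolding differentiable_everywhere_def grad_def by (meson someI)

lemma grad_carrier:
  "differentiable_everywhere d f \<Longrightarrow> x \<in> carrier_vec d \<Longrightarrow> grad d f x \<in> carrier_vec d"
  using differentiable_has_gradient by (auto simp: has_gradient_def)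

text \<open>For differentiable summands this is the gradient of \<open>objective n F\<close>, free
  of the choice operator. It has the componentwise shape of \<open>batch_grad\<close>, so sampling
  errors can be compared entry by entry.\<close>

definition mean_grad :: "nat \<Rightarrow> nat \<Rightarrow> (nat \<Rightarrow> real vec \<Rightarrow> real) \<Rightarrow> real vec \<Rightarrow> real vec" where
  "mean_grad d n F x = vec d (\<lambda>j. (\<Sum>i=1..n. grad d (F i) x $ j) / real n)"

lemma mean_grad_carrier [simp]: "mean_grad d n F x \<in> carrier_vec d"
  by (simp add: mean_grad_def)

lemma scalar_prod_mean_grad:
  assumes "\<And>i. i \<in> {1..n} \<Longrightarrow> grad d (F i) x \<in> carrier_vec d" "h \<in> carrier_vec d"
  shows "mean_grad d n F x \<bullet> h = (\<Sum>i=1..n. grad d (F i) x \<bullet> h) / real n"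
proof -
  have "mean_grad d n F x \<bullet> h = (\<Sum>j<d. \<Sum>i=1..n. grad d (F i) x $ j * h $ j / real n)"
    using assms(2)
    by (simp add: mean_grad_def scalar_prod_def lessThan_atLeast0 sum_distrib_right sum_divide_distrib)
  also have "\<dots> = (\<Sum>i=1..n. \<Sum>j<d. grad d (F i) x $ j * h $ j / real n)"
    by (rule sum.swap)
  also have "\<dots> = (\<Sum>i=1..n. grad d (F i) x \<bullet> h) / real n"
    using assms by (simp add: scalar_prod_def lessThan_atLeast0 sum_divide_distrib)
  finally show ?thesis .
qed

text \<open>Each summand has its own radius for a given tolerance; the least of these finitely many
  radii serves the average.\<close>

lemma has_gradient_objective:
  assumes n: "n \<ge> 1" and D: "\<And>i. i \<in> {1..n} \<Longrightarrow> differentiable_everywhere d (F i)"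
    and x: "x \<in> carrier_vec d"
  shows "has_gradient d (objective n F) (mean_grad d n F x) x"
  unfolding has_gradient_def
proof (intro conjI allI impI)
  show "mean_grad d n F x \<in> carrier_vec d" by simp
  fix e :: real assume e: "e > 0"
  have G: "has_gradient d (F i) (grad d (F i) x) x" if "i \<in> {1..n}" for i
    using D[OF that] x differentiable_has_gradient by blast
  hence gc: "grad d (F i) x \<in> carrier_vec d" if "i \<in> {1..n}" for i
    using that by (auto simp: has_gradient_def)
  have "\<forall>i\<in>{1..n}. \<exists>r>0. \<forall>h\<in>carrier_vec d. vnorm h < r \<longrightarrow>
      \<bar>F i (x + h) - F i x - grad d (F i) x \<bullet> h\<bar> \<le> e * vnorm h"
    using G e unfolding has_gradient_def by blast
  then obtain R where R: "\<And>i. i \<in> {1..n} \<Longrightarrow> R i > 0"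
    "\<And>i h. i \<in> {1..n} \<Longrightarrow> h \<in> carrier_vec d \<Longrightarrow> vnorm h < R i \<Longrightarrow>
      \<bar>F i (x + h) - F i x - grad d (F i) x \<bullet> h\<bar> \<le> e * vnorm h"
    by metis
  define r where "r = Min (R ` {1..n})"
  have ne: "R ` {1..n} \<noteq> {}" "finite (R ` {1..n})" using n by auto
  have "r > 0" unfolding r_def using R(1) ne by (subst Min_gr_iff) auto
  moreover have "\<bar>objective n F (x + h) - objective n F x - mean_grad d n F x \<bullet> h\<bar> \<le> e * vnorm h"
    if h: "h \<in> carrier_vec d" "vnorm h < r" for h
  proof -
    have hr: "vnorm h < R i" if "i \<in> {1..n}" for i
      using h(2) Min_le[OF ne(2), of "R i"] that unfolding r_def by fastforce
    have "objective n F (x + h) - objective n F x - mean_grad d n F x \<bullet> h =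
        (\<Sum>i=1..n. F i (x + h) - F i x - grad d (F i) x \<bullet> h) / real n"
      using gc h(1) by (subst scalar_prod_mean_grad)
        (auto simp: objective_def sum_subtractf diff_divide_distrib)
    also have "\<bar>\<dots>\<bar> = \<bar>\<Sum>i=1..n. F i (x + h) - F i x - grad d (F i) x \<bullet> h\<bar> / real n"
      by simp
    also have "\<dots> \<le> (\<Sum>i=1..n. e * vnorm h) / real n"
      using R(2)[OF _ h(1) hr]
      by (intro divide_right_mono order.trans[OF sum_abs] sum_mono) auto
    also have "\<dots> = e * vnorm h" using n by simp
    finally show ?thesis .
  qed
  ultimately show "\<exists>r>0. \<forall>h\<in>carrier_vec d. vnorm h < r \<longrightarrow>
      \<bar>objective n F (x + h) - objective n F x - mean_grad d n F x \<bullet> h\<bar> \<le> e * vnorm h"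
    by blast
qed

lemma sum_mean_power2_le:
  fixes a :: "'a \<Rightarrow> real"
  shows "((\<Sum>i\<in>A. a i) / real (card A))\<^sup>2 \<le> (\<Sum>i\<in>A. (a i)\<^sup>2) / real (card A)"
proof (cases "card A = 0")
  case False
  have "(\<Sum>i\<in>A. a i)\<^sup>2 \<le> (\<Sum>i\<in>A. (a i)\<^sup>2) * real (card A)"
    using Cauchy_Schwarz_ineq_sum[of a "\<lambda>_. 1" A] by simp
  thus ?thesis using False by (simp add: power_divide power2_eq_square field_simps)
qed simp

text \<open>Coordinatewise, the square of an average is at most the average of the squares. Summing
  over the coordinates gives the same for squared norms, and each summand is then bounded by its own
  Lipschitz estimate.\<close>

lemma smooth_objective:
  assumes n: "n \<ge> 1" and S: "\<And>i. i \<in> {1..n} \<Longrightarrow> smooth d L (F i)" and "L \<ge> 0"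
  shows "smooth d L (objective n F)"
proof -
  have D: "\<And>i. i \<in> {1..n} \<Longrightarrow> differentiable_everywhere d (F i)"
    using S by (auto simp: smooth_def)
  have g: "has_gradient d (objective n F) (mean_grad d n F x) x" if "x \<in> carrier_vec d" for x
    using has_gradient_objective[OF n D that] .
  have ge: "grad d (objective n F) x = mean_grad d n F x" if "x \<in> carrier_vec d" for x
    using g[OF that] by (rule grad_eqI)
  have "vnorm (mean_grad d n F x - mean_grad d n F y) \<le> L * vnorm (x - y)"
    if x: "x \<in> carrier_vec d" and y: "y \<in> carrier_vec d" for x y
  proof (rule power2_le_imp_le)
    have c: "grad d (F i) x - grad d (F i) y \<in> carrier_vec d" if "i \<in> {1..n}" for i
      using grad_carrier[OF D[OF that]] x y by auto
    have "(vnorm (mean_grad d n F x - mean_grad d n F y))\<^sup>2 =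
        (\<Sum>j<d. ((\<Sum>i=1..n. grad d (F i) x $ j - grad d (F i) y $ j) / real n)\<^sup>2)"
      by (subst vnorm_power2_sum[of _ d])
        (auto simp: mean_grad_def sum_subtractf diff_divide_distrib)
    also have "\<dots> \<le> (\<Sum>j<d. (\<Sum>i=1..n. (grad d (F i) x $ j - grad d (F i) y $ j)\<^sup>2) / real n)"
      using sum_mean_power2_le[where A = "{1..n}"] by (intro sum_mono) simp
    also have "\<dots> = (\<Sum>i=1..n. (\<Sum>j<d. (grad d (F i) x $ j - grad d (F i) y $ j)\<^sup>2)) / real n"
      by (subst sum.swap) (simp add: sum_divide_distrib)
    also have "\<dots> = (\<Sum>i=1..n. (vnorm (grad d (F i) x - grad d (F i) y))\<^sup>2) / real n"
    proof -
      have "(\<Sum>j<d. (grad d (F i) x $ j - grad d (F i) y $ j)\<^sup>2) =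
          (vnorm (grad d (F i) x - grad d (F i) y))\<^sup>2" if "i \<in> {1..n}" for i
        using c[OF that] grad_carrier[OF D[OF that] x] grad_carrier[OF D[OF that] y]
        by (subst vnorm_power2_sum[of _ d]) (auto intro!: sum.cong)
      thus ?thesis by simp
    qed
    also have "\<dots> \<le> (\<Sum>i=1..n. (L * vnorm (x - y))\<^sup>2) / real n"
      using S x y by (intro divide_right_mono sum_mono power_mono) (auto simp: smooth_def)
    also have "\<dots> = (L * vnorm (x - y))\<^sup>2" using n by simp
    finally show "(vnorm (mean_grad d n F x - mean_grad d n F y))\<^sup>2 \<le> (L * vnorm (x - y))\<^sup>2" .
  qed (use \<open>L \<ge> 0\<close> in auto)
  thus ?thesis
    using g ge by (auto simp: smooth_def differentiable_everywhere_def)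
qed

text \<open>Restricting to a line turns the gradient on \<open>carrier_vec d\<close> into an
  ordinary derivative, so that monotonicity results for real functions apply.\<close>

lemma has_gradient_line_DERIV:
  assumes f: "differentiable_everywhere d f" and x: "x \<in> carrier_vec d" and h: "h \<in> carrier_vec d"
  shows "((\<lambda>t. f (x + t \<cdot>\<^sub>v h)) has_real_derivative grad d f (x + t \<cdot>\<^sub>v h) \<bullet> h) (at t)"
proof -
  let ?y = "x + t \<cdot>\<^sub>v h"
  have y: "?y \<in> carrier_vec d" using x h by simp
  have G: "has_gradient d f (grad d f ?y) ?y" using differentiable_has_gradient[OF f y] .
  have gc: "grad d f ?y \<in> carrier_vec d" using G by (simp add: has_gradient_def)
  have "(\<lambda>s. (f (x + (t + s) \<cdot>\<^sub>v h) - f ?y) / s) \<midarrow>0\<rightarrow> grad d f ?y \<bullet> h"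
  proof (rule LIM_I)
    fix e :: real assume e: "e > 0"
    \<comment> \<open>The \<open>+ 1\<close> keeps the quotient meaningful for a zero direction; the
      factor 2 makes the final estimate strict.\<close>
    define e' where "e' = e / (2 * (vnorm h + 1))"
    have h1: "vnorm h + 1 > 0" using vnorm_nonneg[of h] by linarith
    have e': "e' > 0" using e h1 by (simp add: e'_def)
    then obtain r where r: "r > 0" "\<And>k. k \<in> carrier_vec d \<Longrightarrow> vnorm k < r \<Longrightarrow>
        \<bar>f (?y + k) - f ?y - grad d f ?y \<bullet> k\<bar> \<le> e' * vnorm k"
      using G unfolding has_gradient_def by meson
    show "\<exists>\<rho>>0. \<forall>s. s \<noteq> 0 \<and> norm (s - 0) < \<rho> \<longrightarrow>
        norm ((f (x + (t + s) \<cdot>\<^sub>v h) - f ?y) / s - grad d f ?y \<bullet> h) < e"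
    proof (intro exI[of _ "r / (vnorm h + 1)"] conjI allI impI)
      show "r / (vnorm h + 1) > 0" using r h1 by simp
      fix s :: real assume s: "s \<noteq> 0 \<and> norm (s - 0) < r / (vnorm h + 1)"
      have "\<bar>s\<bar> * (vnorm h + 1) < r" using s h1 by (simp add: field_simps)
      hence "\<bar>s\<bar> * vnorm h < r" by (simp add: distrib_left)
      hence "\<bar>f (?y + s \<cdot>\<^sub>v h) - f ?y - grad d f ?y \<bullet> (s \<cdot>\<^sub>v h)\<bar> \<le> e' * vnorm (s \<cdot>\<^sub>v h)"
        using r(2)[of "s \<cdot>\<^sub>v h"] h by (simp add: vnorm_smult)
      moreover have "?y + s \<cdot>\<^sub>v h = x + (t + s) \<cdot>\<^sub>v h"
        using x h by (intro eq_vecI) (auto simp: distrib_right)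
      ultimately have "\<bar>f (x + (t + s) \<cdot>\<^sub>v h) - f ?y - s * (grad d f ?y \<bullet> h)\<bar> \<le> \<bar>s\<bar> * (e' * vnorm h)"
        using gc h by (simp add: vnorm_smult mult_ac)
      moreover have "(f (x + (t + s) \<cdot>\<^sub>v h) - f ?y) / s - grad d f ?y \<bullet> h =
          (f (x + (t + s) \<cdot>\<^sub>v h) - f ?y - s * (grad d f ?y \<bullet> h)) / s"
        using s by (simp add: field_simps)
      ultimately have "\<bar>(f (x + (t + s) \<cdot>\<^sub>v h) - f ?y) / s - grad d f ?y \<bullet> h\<bar> \<le> e' * vnorm h"
        using s by (simp add: abs_divide divide_le_eq mult.commute)
      also have "\<dots> \<le> e' * (vnorm h + 1)" using e' by (simp add: distrib_left)
      also have "\<dots> = e / 2" using h1 unfolding e'_def by (auto simp: divide_simps)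
      also have "\<dots> < e" using e by simp
      finally show "norm ((f (x + (t + s) \<cdot>\<^sub>v h) - f ?y) / s - grad d f ?y \<bullet> h) < e" by simp
    qed
  qed
  thus ?thesis by (simp add: DERIV_def)
qed

text \<open>Along the segment, \<open>\<psi>\<close> is \<open>f\<close> minus the linear term and
  the quadratic term of the bound. Lipschitz continuity of the gradient makes its derivative
  nonpositive on the unit interval.\<close>

lemma smooth_descent:
  assumes S: "smooth d L f" and x: "x \<in> carrier_vec d" and h: "h \<in> carrier_vec d"
  shows "f (x + h) \<le> f x + grad d f x \<bullet> h + L / 2 * (vnorm h)\<^sup>2"
proof -
  have D: "differentiable_everywhere d f" using S by (simp add: smooth_def)
  define \<psi> where "\<psi> t = f (x + t \<cdot>\<^sub>v h) - t * (grad d f x \<bullet> h) - L / 2 * t\<^sup>2 * (vnorm h)\<^sup>2" for t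
  have "\<psi> 1 \<le> \<psi> 0"
  proof (rule DERIV_nonpos_imp_nonincreasing[where f = \<psi>])
    fix t :: real assume t: "0 \<le> t" "t \<le> 1"
    let ?y = "x + t \<cdot>\<^sub>v h"
    have y: "?y \<in> carrier_vec d" using x h by simp
    have "(\<psi> has_real_derivative
        grad d f ?y \<bullet> h - grad d f x \<bullet> h - L * t * (vnorm h)\<^sup>2) (at t)"
      unfolding \<psi>_def
      by (rule derivative_eq_intros has_gradient_line_DERIV[OF D x h] refl)+ simp
    moreover have "grad d f ?y \<bullet> h - grad d f x \<bullet> h \<le> L * t * (vnorm h)\<^sup>2"
    proof -
      have c: "grad d f ?y \<in> carrier_vec d" "grad d f x \<in> carrier_vec d"
        using grad_carrier[OF D] x y by auto
      have "?y - x = t \<cdot>\<^sub>v h" using x h by (intro eq_vecI) auto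
      hence "vnorm (grad d f ?y - grad d f x) \<le> L * (t * vnorm h)"
        using S x y t unfolding smooth_def by (metis abs_of_nonneg vnorm_smult)
      hence "vnorm (grad d f ?y - grad d f x) * vnorm h \<le> L * (t * vnorm h) * vnorm h"
        by (rule mult_right_mono) simp
      moreover have "grad d f ?y \<bullet> h - grad d f x \<bullet> h = (grad d f ?y - grad d f x) \<bullet> h"
        using c h by (simp add: minus_scalar_prod_distrib[of _ d])
      moreover have "(grad d f ?y - grad d f x) \<bullet> h \<le> vnorm (grad d f ?y - grad d f x) * vnorm h"
        using c h by (intro scalar_prod_le_vnorm[of _ d]) auto
      ultimately show ?thesis by (simp add: power2_eq_square mult_ac)
    qed
    ultimately show "\<exists>y. (\<psi> has_real_derivative y) (at t) \<and> y \<le> 0"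
      by (intro exI[of _ "grad d f ?y \<bullet> h - grad d f x \<bullet> h - L * t * (vnorm h)\<^sup>2"]) auto
  qed simp
  moreover have "x + 0 \<cdot>\<^sub>v h = x" using x h by (intro eq_vecI) auto
  ultimately show ?thesis by (simp add: \<psi>_def)
qed

section \<open>Matrices between two multiples of the identity\<close>

lemma loewner_le_carrier:
  "loewner_le d (a \<cdot>\<^sub>m 1\<^sub>m d) H \<Longrightarrow> H \<in> carrier_mat d d"
  by (simp add: loewner_le_def)

lemma scaled_one_mult_vec:
  fixes u :: "real vec"
  assumes "u \<in> carrier_vec d" shows "(a \<cdot>\<^sub>m 1\<^sub>m d) *\<^sub>v u = a \<cdot>\<^sub>v u"
  using assms by (intro eq_vecI) auto

lemma loewner_le_quadratic:
  assumes lo: "loewner_le d (a \<cdot>\<^sub>m 1\<^sub>m d) H" and hi: "loewner_le d H (b \<cdot>\<^sub>m 1\<^sub>m d)"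
    and u: "u \<in> carrier_vec d"
  shows "a * (vnorm u)\<^sup>2 \<le> u \<bullet> (H *\<^sub>v u)" and "u \<bullet> (H *\<^sub>v u) \<le> b * (vnorm u)\<^sup>2"
proof -
  have H: "H \<in> carrier_mat d d" using lo by (simp add: loewner_le_def)
  have "0 \<le> u \<bullet> ((H - a \<cdot>\<^sub>m 1\<^sub>m d) *\<^sub>v u)" using lo u by (simp add: loewner_le_def psd_def)
  also have "\<dots> = u \<bullet> (H *\<^sub>v u) - a * (vnorm u)\<^sup>2"
    using H u by (simp add: minus_mult_distrib_mat_vec[of _ d d] scaled_one_mult_vec
        scalar_prod_minus_distrib[of _ d] vnorm_power2)
  finally show "a * (vnorm u)\<^sup>2 \<le> u \<bullet> (H *\<^sub>v u)" by simp
  have "0 \<le> u \<bullet> ((b \<cdot>\<^sub>m 1\<^sub>m d - H) *\<^sub>v u)" using hi u by (simp add: loewner_le_def psd_def)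
  also have "\<dots> = b * (vnorm u)\<^sup>2 - u \<bullet> (H *\<^sub>v u)"
    using H u by (simp add: minus_mult_distrib_mat_vec[of _ d d] scaled_one_mult_vec
        scalar_prod_minus_distrib[of _ d] vnorm_power2)
  finally show "u \<bullet> (H *\<^sub>v u) \<le> b * (vnorm u)\<^sup>2" by simp
qed

text \<open>Symmetry is part of \<open>psd\<close>, and it passes from
  \<open>H - a \<cdot>\<^sub>m 1\<^sub>m d\<close> to \<open>H\<close> because the two differ by a
  diagonal matrix.\<close>

lemma loewner_le_symmetric:
  assumes "loewner_le d (a \<cdot>\<^sub>m 1\<^sub>m d) H" "u \<in> carrier_vec d" "w \<in> carrier_vec d"
  shows "u \<bullet> (H *\<^sub>v w) = w \<bullet> (H *\<^sub>v u)"
proof -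
  have H: "H \<in> carrier_mat d d" and T: "(H - a \<cdot>\<^sub>m 1\<^sub>m d)\<^sup>T = H - a \<cdot>\<^sub>m 1\<^sub>m d"
    using assms by (auto simp: loewner_le_def psd_def)
  have "H\<^sup>T = H"
  proof (rule eq_matI)
    fix i j assume ij: "i < dim_row H" "j < dim_col H"
    have "(H - a \<cdot>\<^sub>m 1\<^sub>m d)\<^sup>T $$ (i, j) = (H - a \<cdot>\<^sub>m 1\<^sub>m d) $$ (i, j)" using T by simp
    thus "H\<^sup>T $$ (i, j) = H $$ (i, j)" using ij H by (auto split: if_splits)
  qed (use H in auto)
  have "u \<bullet> (H *\<^sub>v w) = (H\<^sup>T *\<^sub>v u) \<bullet> w"
    using transpose_vec_mult_scalar[OF H assms(3,2)] by simp
  also have "\<dots> = w \<bullet> (H *\<^sub>v u)"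
    using assms H by (simp add: \<open>H\<^sup>T = H\<close> comm_scalar_prod[of _ d])
  finally show ?thesis .
qed

text \<open>Instead of a spectral decomposition: expand the quadratic form of \<open>H\<close> at \<open>u - (1/b) H u\<close>.\<close>

lemma loewner_le_image_norm:
  assumes lo: "loewner_le d (a \<cdot>\<^sub>m 1\<^sub>m d) H" and hi: "loewner_le d H (b \<cdot>\<^sub>m 1\<^sub>m d)"
    and "a \<ge> 0" "b > 0" and u: "u \<in> carrier_vec d"
  shows "(vnorm (H *\<^sub>v u))\<^sup>2 \<le> b * (u \<bullet> (H *\<^sub>v u))"
proof -
  have H: "H \<in> carrier_mat d d" using lo by (simp add: loewner_le_def)
  let ?w = "H *\<^sub>v u" and ?c = "- 1 / b"
  have w: "?w \<in> carrier_vec d" using H u by simp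
  have Hw: "H *\<^sub>v ?w \<in> carrier_vec d" using H w by (rule mult_mat_vec_carrier)
  have "0 \<le> a * (vnorm (u + ?c \<cdot>\<^sub>v ?w))\<^sup>2" using \<open>a \<ge> 0\<close> by simp
  also have "\<dots> \<le> (u + ?c \<cdot>\<^sub>v ?w) \<bullet> (H *\<^sub>v (u + ?c \<cdot>\<^sub>v ?w))"
    using loewner_le_quadratic(1)[OF lo hi, of "u + ?c \<cdot>\<^sub>v ?w"] u w by simp
  also have "\<dots> = (u + ?c \<cdot>\<^sub>v ?w) \<bullet> (?w + ?c \<cdot>\<^sub>v (H *\<^sub>v ?w))"
    using H u w by (simp add: mult_add_distrib_mat_vec[of _ d d] mult_mat_vec[of _ d d])
  also have "\<dots> = u \<bullet> ?w + ?c * (u \<bullet> (H *\<^sub>v ?w)) + ?c * (?w \<bullet> ?w) + ?c * (?c * (?w \<bullet> (H *\<^sub>v ?w)))"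
  proof -
    have "?c \<cdot>\<^sub>v (H *\<^sub>v ?w) \<in> carrier_vec d" "?c \<cdot>\<^sub>v ?w \<in> carrier_vec d" using Hw w by simp_all
    thus ?thesis
    using u w Hw
    by (simp only: add_scalar_prod_distrib[of _ d] scalar_prod_add_distrib[of _ d] add_carrier_vec
        smult_scalar_prod_distrib[of _ d] scalar_prod_smult_distrib[of _ d] distrib_left add.assoc)
  qed
  also have "u \<bullet> (H *\<^sub>v ?w) = ?w \<bullet> ?w" using loewner_le_symmetric[OF lo u w] .
  also have "?w \<bullet> ?w = (vnorm ?w)\<^sup>2" by (simp add: vnorm_power2)
  finally have "0 \<le> u \<bullet> ?w - 2 / b * (vnorm ?w)\<^sup>2 + (?w \<bullet> (H *\<^sub>v ?w)) / b\<^sup>2"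
    by (simp add: power2_eq_square)
  \<comment> \<open>The upper bound on \<open>H\<close> is applied at the image \<open>?w\<close>;
    half of the negative term then pays for this one.\<close>
  also have "(?w \<bullet> (H *\<^sub>v ?w)) / b\<^sup>2 \<le> b * (vnorm ?w)\<^sup>2 / b\<^sup>2"
    using loewner_le_quadratic(2)[OF lo hi w] by (intro divide_right_mono) auto
  finally show ?thesis using \<open>b > 0\<close> by (simp add: field_simps power2_eq_square)
qed

text \<open>Cauchy-Schwarz against the lower quadratic bound. It later recovers a bound on the
  estimate \<open>v\<close> from one on the direction.\<close>

lemma loewner_le_norm_lower:
  assumes lo: "loewner_le d (a \<cdot>\<^sub>m 1\<^sub>m d) H" and hi: "loewner_le d H (b \<cdot>\<^sub>m 1\<^sub>m d)"
    and u: "u \<in> carrier_vec d"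
  shows "a * vnorm u \<le> vnorm (H *\<^sub>v u)"
proof (cases "vnorm u = 0")
  case False
  have H: "H \<in> carrier_mat d d" using lo by (simp add: loewner_le_def)
  have "a * (vnorm u)\<^sup>2 \<le> vnorm u * vnorm (H *\<^sub>v u)"
    using loewner_le_quadratic(1)[OF lo hi u] scalar_prod_le_vnorm[of u d "H *\<^sub>v u"] u H by simp
  hence "vnorm u * (a * vnorm u) \<le> vnorm u * vnorm (H *\<^sub>v u)" by (simp add: power2_eq_square mult_ac)
  thus ?thesis using False vnorm_nonneg[of u] by (simp add: mult_le_cancel_left)
qed simp

text \<open>Evaluate both bounds at a unit vector, which exists only in positive dimension. This
  comparison makes the prescribed step size small enough.\<close>

lemma loewner_le_scalars:
  assumes lo: "loewner_le d (a \<cdot>\<^sub>m 1\<^sub>m d) H" and hi: "loewner_le d H (b \<cdot>\<^sub>m 1\<^sub>m d)" and "d > 0"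
  shows "a \<le> b"
proof -
  have "(vnorm (unit_vec d 0))\<^sup>2 = 1" using \<open>d > 0\<close> by (simp add: vnorm_power2)
  thus ?thesis using loewner_le_quadratic[OF lo hi, of "unit_vec d 0"] by simp
qed

section \<open>Resampling one mini-batch\<close>

text \<open>Fubini as a rearrangement of finite sums: finite support removes every integrability
  condition.\<close>

lemma expectation_pair_pmf_finite:
  fixes f :: "'a \<times> 'b \<Rightarrow> real"
  assumes p: "finite (set_pmf p)" and r: "finite (set_pmf r)"
  shows "measure_pmf.expectation (pair_pmf p r) f =
    measure_pmf.expectation p (\<lambda>a. measure_pmf.expectation r (\<lambda>b. f (a, b)))"
proof -
  have "measure_pmf.expectation (pair_pmf p r) f =
      (\<Sum>ab\<in>set_pmf p \<times> set_pmf r. pmf (pair_pmf p r) ab * f ab)"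
    using p r by (subst integral_measure_pmf[of "set_pmf p \<times> set_pmf r"]) auto
  also have "\<dots> = (\<Sum>a\<in>set_pmf p. pmf p a * (\<Sum>b\<in>set_pmf r. pmf r b * f (a, b)))"
    by (simp add: sum.cartesian_product' pmf_pair sum_distrib_left mult.assoc)
  also have "\<dots> = measure_pmf.expectation p (\<lambda>a. measure_pmf.expectation r (\<lambda>b. f (a, b)))"
    using p r by (subst integral_measure_pmf[of "set_pmf p"], simp_all)
      (subst integral_measure_pmf[of "set_pmf r"], simp_all)
  finally show ?thesis .
qed

lemma expectation_swap_pmf:
  fixes f :: "'a \<Rightarrow> 'b \<Rightarrow> real"
  assumes p: "finite (set_pmf p)" and r: "finite (set_pmf r)"
  shows "measure_pmf.expectation p (\<lambda>a. measure_pmf.expectation r (\<lambda>b. f a b)) =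
    measure_pmf.expectation r (\<lambda>b. measure_pmf.expectation p (\<lambda>a. f a b))"
proof -
  have "measure_pmf.expectation p (\<lambda>a. measure_pmf.expectation r (\<lambda>b. f a b)) =
      measure_pmf.expectation (pair_pmf p r) (\<lambda>ab. f (fst ab) (snd ab))"
    by (subst expectation_pair_pmf_finite[OF p r]) simp
  also have "\<dots> = measure_pmf.expectation (pair_pmf r p) (\<lambda>ba. f (snd ba) (fst ba))"
    by (subst pair_commute_pmf) (simp add: case_prod_beta)
  also have "\<dots> = measure_pmf.expectation r (\<lambda>b. measure_pmf.expectation p (\<lambda>a. f a b))"
    by (subst expectation_pair_pmf_finite[OF r p]) simp
  finally show ?thesis .
qed

lemma expectation_mono_pmf:
  fixes f g :: "'a \<Rightarrow> real"
  assumes "finite (set_pmf p)" "\<And>a. a \<in> set_pmf p \<Longrightarrow> f a \<le> g a"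
  shows "measure_pmf.expectation p f \<le> measure_pmf.expectation p g"
  using assms by (intro integral_mono_AE integrable_measure_pmf_finite AE_pmfI) auto

lemma expectation_cong_pmf:
  fixes f g :: "'a \<Rightarrow> real"
  assumes "\<And>a. a \<in> set_pmf p \<Longrightarrow> f a = g a"
  shows "measure_pmf.expectation p f = measure_pmf.expectation p g"
  using assms by (intro integral_cong_AE AE_pmfI) auto

lemma expectation_power2_le:
  fixes f :: "'a \<Rightarrow> real"
  assumes p: "finite (set_pmf p)"
  shows "(measure_pmf.expectation p f)\<^sup>2 \<le> measure_pmf.expectation p (\<lambda>a. (f a)\<^sup>2)"
proof -
  define \<mu> where "\<mu> = measure_pmf.expectation p f"
  note [simp] = integrable_measure_pmf_finite[OF p]
  have "0 \<le> measure_pmf.expectation p (\<lambda>a. (f a - \<mu>)\<^sup>2)" by (intro Bochner_Integration.integral_nonneg) auto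
  also have "\<dots> = measure_pmf.expectation p (\<lambda>a. (f a)\<^sup>2) - 2 * \<mu> * measure_pmf.expectation p f + \<mu>\<^sup>2"
    by (simp add: power2_diff mult.assoc mult.commute[of _ \<mu>] mult.left_commute[of _ \<mu>])
  finally show ?thesis by (simp add: \<mu>_def power2_eq_square)
qed

text \<open>Peel off the first draw: its cross term vanishes because \<open>h\<close> is centred, so
  variances add. The offset \<open>c\<close> is general because the induction shifts it by that
  draw, and finiteness of the support is proved alongside because the product formula needs
  it.\<close>

lemma expectation_replicate_pmf_square:
  fixes h :: "'a \<Rightarrow> real"
  assumes p: "finite (set_pmf p)" and h: "measure_pmf.expectation p h = 0"
  shows "finite (set_pmf (replicate_pmf b p)) \<and>
    measure_pmf.expectation (replicate_pmf b p) (\<lambda>I. (c + t * (\<Sum>i\<leftarrow>I. h i))\<^sup>2) =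
      c\<^sup>2 + t\<^sup>2 * real b * measure_pmf.expectation p (\<lambda>i. (h i)\<^sup>2)"
proof (induction b arbitrary: c)
  case 0
  show ?case by simp
next
  case (Suc b)
  let ?r = "replicate_pmf b p" and ?V = "measure_pmf.expectation p (\<lambda>i. (h i)\<^sup>2)"
  have r: "finite (set_pmf ?r)" using Suc by blast
  have eq: "replicate_pmf (Suc b) p = map_pmf (\<lambda>(x, xs). x # xs) (pair_pmf p ?r)"
    by (simp add: pair_pmf_def map_bind_pmf bind_return_pmf map_pmf_def bind_assoc_pmf)
  note [simp] = integrable_measure_pmf_finite[OF p]
  have "measure_pmf.expectation (replicate_pmf (Suc b) p) (\<lambda>I. (c + t * (\<Sum>i\<leftarrow>I. h i))\<^sup>2) =
      measure_pmf.expectation p (\<lambda>x. measure_pmf.expectation ?r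
        (\<lambda>xs. (c + t * h x + t * (\<Sum>i\<leftarrow>xs. h i))\<^sup>2))"
    unfolding eq integral_map_pmf
    by (subst expectation_pair_pmf_finite[OF p r]) (simp add: algebra_simps)
  also have "\<dots> = measure_pmf.expectation p (\<lambda>x. (c + t * h x)\<^sup>2 + t\<^sup>2 * real b * ?V)"
    using Suc by simp
  also have "\<dots> = measure_pmf.expectation p
      (\<lambda>x. (c\<^sup>2 + t\<^sup>2 * real b * ?V) + (2 * c * t) * h x + t\<^sup>2 * (h x)\<^sup>2)"
    by (simp add: power2_sum power_mult_distrib algebra_simps)
  also have "\<dots> = c\<^sup>2 + t\<^sup>2 * real (Suc b) * ?V"
    using h by (simp add: algebra_simps)
  finally show ?case using p r by (simp add: eq)
qed

text \<open>The coordinates are independent, so redrawing one of them preserves the law. This takes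
  the place of conditioning on the other mini-batches.\<close>

lemma expectation_Pi_pmf_resample:
  fixes \<phi> :: "('a \<Rightarrow> 'b) \<Rightarrow> real"
  assumes A: "finite A" "k \<in> A" and p: "\<And>i. i \<in> A \<Longrightarrow> finite (set_pmf (p i))"
  shows "measure_pmf.expectation (Pi_pmf A dflt p) \<phi> =
    measure_pmf.expectation (Pi_pmf A dflt p) (\<lambda>\<xi>. measure_pmf.expectation (p k) (\<lambda>\<eta>. \<phi> (\<xi>(k := \<eta>))))"
proof -
  define Q where "Q = Pi_pmf (A - {k}) dflt p"
  have Q: "finite (set_pmf Q)"
    unfolding Q_def using A p by (subst set_Pi_pmf) (auto intro!: finite_PiE_dflt)
  have pk: "finite (set_pmf (p k))" using A p by blast
  have eq: "Pi_pmf A dflt p = map_pmf (\<lambda>(y, f). f(k := y)) (pair_pmf (p k) Q)"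
    using Pi_pmf_insert[of "A - {k}" k dflt p] A by (simp add: Q_def insert_absorb)
  have E: "measure_pmf.expectation (Pi_pmf A dflt p) \<psi> =
      measure_pmf.expectation (p k) (\<lambda>\<eta>. measure_pmf.expectation Q (\<lambda>f. \<psi> (f(k := \<eta>))))"
    for \<psi> :: "('a \<Rightarrow> 'b) \<Rightarrow> real"
    unfolding eq integral_map_pmf by (subst expectation_pair_pmf_finite[OF pk Q]) simp
  show ?thesis
    unfolding E[of \<phi>] E[of "\<lambda>\<xi>. measure_pmf.expectation (p k) (\<lambda>\<eta>. \<phi> (\<xi>(k := \<eta>)))"]
    using expectation_swap_pmf[OF pk Q, of "\<lambda>\<eta> f. \<phi> (f(k := \<eta>))"] by simp
qed

section \<open>Mini-batches\<close>

lemma batch_law_support: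
  assumes n: "n \<ge> 1"
  shows "finite (set_pmf (batch_law n q b K))"
    and "set_pmf (batch_law n q b K) = {\<xi>. \<forall>k. if k < K \<and> k mod q \<noteq> 0
      then length (\<xi> k) = b \<and> set (\<xi> k) \<subseteq> {1..n} else \<xi> k = []}"
proof -
  have s: "set_pmf (replicate_pmf b (pmf_of_set {1..n})) = {I. length I = b \<and> set I \<subseteq> {1..n}}"
    using n by (auto simp: set_replicate_pmf)
  have f: "finite {I. length I = b \<and> set I \<subseteq> {1..n}}"
    using finite_lists_length_eq[of "{1..n}" b] by (simp add: conj_commute)
  show "finite (set_pmf (batch_law n q b K))"
    unfolding batch_law_def using f
    by (subst set_Pi_pmf) (auto intro!: finite_PiE_dflt simp del: One_nat_def simp: s)
  show "set_pmf (batch_law n q b K) = {\<xi>. \<forall>k. if k < K \<and> k mod q \<noteq> 0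
      then length (\<xi> k) = b \<and> set (\<xi> k) \<subseteq> {1..n} else \<xi> k = []}"
    unfolding batch_law_def
    by (subst set_Pi_pmf, simp, unfold PiE_dflt_def o_def s, rule Collect_cong, rule all_cong1)
      (auto simp del: One_nat_def)
qed

lemma expectation_batch_law_resample:
  fixes \<phi> :: "(nat \<Rightarrow> nat list) \<Rightarrow> real"
  assumes n: "n \<ge> 1" and k: "k < K" "k mod q \<noteq> 0"
  shows "measure_pmf.expectation (batch_law n q b K) \<phi> =
    measure_pmf.expectation (batch_law n q b K)
      (\<lambda>\<xi>. measure_pmf.expectation (replicate_pmf b (pmf_of_set {1..n})) (\<lambda>\<eta>. \<phi> (\<xi>(k := \<eta>))))"
proof -
  have "finite (set_pmf (replicate_pmf b (pmf_of_set {1..n})))"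
    using n finite_lists_length_eq[of "{1..n}" b]
    by (auto simp: set_replicate_pmf lists_eq_set conj_commute)
  thus ?thesis
    unfolding batch_law_def using k
    by (intro expectation_Pi_pmf_resample[where p = "\<lambda>_. replicate_pmf b (pmf_of_set {1..n})"]) auto
qed

text \<open>One step of the SPIDER estimator; \<open>c\<close> is the error carried over from the previous step.\<close>

lemma batch_error_variance:
  fixes G :: "nat \<Rightarrow> real vec"
  assumes n: "n \<ge> 1" and b: "b \<ge> 1" and c: "c \<in> carrier_vec d"
    and G: "\<And>i. i \<in> {1..n} \<Longrightarrow> G i \<in> carrier_vec d"
    and R: "\<And>i. i \<in> {1..n} \<Longrightarrow> vnorm (G i) \<le> R"
  shows "measure_pmf.expectation (replicate_pmf b (pmf_of_set {1..n}))
      (\<lambda>I. (vnorm (c + (vec d (\<lambda>j. (\<Sum>i\<leftarrow>I. G i $ j) / real (length I)) -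
        vec d (\<lambda>j. (\<Sum>i=1..n. G i $ j) / real n))))\<^sup>2) \<le> (vnorm c)\<^sup>2 + R\<^sup>2 / real b"
proof -
  define p where "p = pmf_of_set {1..n}"
  define r where "r = replicate_pmf b p"
  have p: "finite (set_pmf p)" using n by (simp add: p_def)
  note [simp] = integrable_measure_pmf_finite[OF p]
  have Ep: "measure_pmf.expectation p h = (\<Sum>i=1..n. h i) / real n" for h :: "nat \<Rightarrow> real"
    using n unfolding p_def by (subst integral_pmf_of_set) auto
  define \<mu> where "\<mu> = (\<lambda>j. (\<Sum>i=1..n. G i $ j) / real n)"
  have z: "measure_pmf.expectation p (\<lambda>i. G i $ j - \<mu> j) = 0" for j
    using n by (simp add: Ep \<mu>_def sum_subtractf)
  have r: "finite (set_pmf r)"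
    unfolding r_def using expectation_replicate_pmf_square[OF p z[of 0]] by blast
  note [simp] = integrable_measure_pmf_finite[OF r]
  let ?m = "\<lambda>I j. (\<Sum>i\<leftarrow>I. G i $ j) / real (length I)"
  have "measure_pmf.expectation r
      (\<lambda>I. (vnorm (c + (vec d (?m I) - vec d \<mu>)))\<^sup>2) =
     measure_pmf.expectation r (\<lambda>I. \<Sum>j<d. (c $ j + 1 / real b * (\<Sum>i\<leftarrow>I. G i $ j - \<mu> j))\<^sup>2)"
  proof (rule expectation_cong_pmf)
    fix I assume "I \<in> set_pmf r"
    hence l: "length I = b" by (simp add: r_def set_replicate_pmf)
    have e: "?m I j - \<mu> j = 1 / real b * (\<Sum>i\<leftarrow>I. G i $ j - \<mu> j)" for j
      using b l by (simp add: sum_list_subtractf sum_list_triv diff_divide_distrib)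
    have "(vnorm (c + (vec d (?m I) - vec d \<mu>)))\<^sup>2 = (\<Sum>j<d. (c $ j + (?m I j - \<mu> j))\<^sup>2)"
      using c by (subst vnorm_power2_sum[of _ d]) auto
    thus "(vnorm (c + (vec d (?m I) - vec d \<mu>)))\<^sup>2 =
        (\<Sum>j<d. (c $ j + 1 / real b * (\<Sum>i\<leftarrow>I. G i $ j - \<mu> j))\<^sup>2)"
      unfolding e .
  qed
  also have "\<dots> = (\<Sum>j<d. (c $ j)\<^sup>2 + (1 / real b)\<^sup>2 * real b *
      measure_pmf.expectation p (\<lambda>i. (G i $ j - \<mu> j)\<^sup>2))"
  proof -
    have "measure_pmf.expectation r (\<lambda>I. \<Sum>j<d. (c $ j + 1 / real b * (\<Sum>i\<leftarrow>I. G i $ j - \<mu> j))\<^sup>2) =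
        (\<Sum>j<d. measure_pmf.expectation r (\<lambda>I. (c $ j + 1 / real b * (\<Sum>i\<leftarrow>I. G i $ j - \<mu> j))\<^sup>2))"
      by (rule Bochner_Integration.integral_sum) simp
    thus ?thesis
      by (simp only: r_def expectation_replicate_pmf_square[OF p z, THEN conjunct2])
  qed
  \<comment> \<open>A variance is at most the second moment; only a bound on the norms of the
    \<open>G i\<close> is then required.\<close>
  also have "\<dots> \<le> (\<Sum>j<d. (c $ j)\<^sup>2 + (\<Sum>i=1..n. (G i $ j)\<^sup>2) / real n / real b)"
  proof (rule sum_mono)
    fix j
    have m: "(\<Sum>i=1..n. G i $ j) = real n * \<mu> j" using n by (simp add: \<mu>_def)
    have "(\<Sum>i=1..n. (G i $ j - \<mu> j)\<^sup>2) = (\<Sum>i=1..n. (G i $ j)\<^sup>2) - 2 * \<mu> j * (\<Sum>i=1..n. G i $ j) + real n * (\<mu> j)\<^sup>2"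
      by (simp add: power2_diff sum.distrib sum_subtractf sum_distrib_left mult_ac)
    also have "\<dots> \<le> (\<Sum>i=1..n. (G i $ j)\<^sup>2)"
      unfolding m by (simp add: power2_eq_square algebra_simps)
    finally have "measure_pmf.expectation p (\<lambda>i. (G i $ j - \<mu> j)\<^sup>2) \<le> (\<Sum>i=1..n. (G i $ j)\<^sup>2) / real n"
      unfolding Ep by (rule divide_right_mono) simp
    hence "measure_pmf.expectation p (\<lambda>i. (G i $ j - \<mu> j)\<^sup>2) / real b
        \<le> (\<Sum>i=1..n. (G i $ j)\<^sup>2) / real n / real b"
      by (rule divide_right_mono) simp
    thus "(c $ j)\<^sup>2 + (1 / real b)\<^sup>2 * real b * measure_pmf.expectation p (\<lambda>i. (G i $ j - \<mu> j)\<^sup>2)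
        \<le> (c $ j)\<^sup>2 + (\<Sum>i=1..n. (G i $ j)\<^sup>2) / real n / real b"
      using b by (simp add: power2_eq_square)
  qed
  also have "\<dots> = (vnorm c)\<^sup>2 + (\<Sum>i=1..n. (vnorm (G i))\<^sup>2) / real n / real b"
  proof -
    have "(\<Sum>j<d. \<Sum>i=1..n. (G i $ j)\<^sup>2) = (\<Sum>i=1..n. (vnorm (G i))\<^sup>2)"
      using G by (subst sum.swap) (simp add: vnorm_power2_sum[of _ d])
    thus ?thesis using c by (simp add: sum.distrib vnorm_power2_sum[of c d] flip: sum_divide_distrib)
  qed
  also have "\<dots> \<le> (vnorm c)\<^sup>2 + (\<Sum>i=1..n. R\<^sup>2) / real n / real b"
    using R by (intro add_left_mono divide_right_mono sum_mono power_mono) auto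
  also have "\<dots> = (vnorm c)\<^sup>2 + R\<^sup>2 / real b" using n by simp
  finally show ?thesis unfolding r_def p_def \<mu>_def .
qed

section \<open>Momentum schedules\<close>

text \<open>\<open>p\<^sub>k\<close> is the weight of \<open>\<parallel>y\<^sub>k - x\<^sub>k\<parallel>\<^sup>2\<close> in the potential, essentially a multiple of \<open>1/\<alpha>\<^sub>k\<close>.
  The first alternative describes an iteration with \<open>z\<^sub>k = x\<^sub>k\<close> and an exact gradient, the last one
  the end of an epoch of the restarted scheme, where \<open>\<alpha>\<^sub>k\<^sub>+\<^sub>1 = 2\<close> reflects \<open>y\<^sub>k\<close> at \<open>x\<^sub>k\<close> but the next
  iteration forgets \<open>y\<^sub>k\<^sub>+\<^sub>1\<close>. The constants \<open>54/5\<close> and \<open>22/5\<close> are tuned to make the decrease budgets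
  below positive.\<close>

definition admissible_step :: "nat \<Rightarrow> (nat \<Rightarrow> real) \<Rightarrow> (nat \<Rightarrow> real) \<Rightarrow> nat \<Rightarrow> bool" where
  "admissible_step q \<alpha> p k \<longleftrightarrow> 0 \<le> p k \<and>
     (k mod q = 0 \<and> \<alpha> (k + 1) = 1 \<and> \<alpha> k \<le> 2 \<and> p (k + 1) \<le> 54/5 \<or>
      0 < \<alpha> (k + 1) \<and> \<alpha> (k + 1) \<le> 1 \<and> \<alpha> k \<le> 1 \<and> \<alpha> k \<le> 3/2 * \<alpha> (k + 1) \<and>
        p (k + 1) * \<alpha> (k + 1) \<le> 54/5 \<and> p (k + 1) * (1 - \<alpha> (k + 1)) + 22/5 \<le> p k \<or>
      \<alpha> (k + 1) = 2 \<and> \<alpha> k \<le> 1 \<and> (k + 1) mod q = 0 \<and> p (k + 1) = 0 \<and> 2 + 88 / (5 * real q) \<le> p k)"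

text \<open>Start, interior and end of an epoch fall under the three alternatives in this order. The
  weight is \<open>54/5\<close> divided by \<open>alpha_MER q k\<close>, except at a restart, where
  it is 0 because the iteration there puts \<open>z\<close> at \<open>x\<close> and forgets
  \<open>y\<close>. For \<open>q = 1\<close> the schedule is constantly 2 and fits no
  alternative.\<close>

lemma alpha_MER_admissible:
  assumes "q \<ge> 2"
  shows "admissible_step q (alpha_MER q) (\<lambda>k. if k mod q = 0 then 0 else 27/5 * (real (k mod q) + 1)) k"
proof -
  define r where "r = k mod q"
  have r: "r < q" using assms by (simp add: r_def)
  have s: "(k + 1) mod q = (if r + 1 = q then 0 else r + 1)"
    using assms by (auto simp: r_def mod_Suc)
  consider "r = 0" | "r \<noteq> 0" "r + 1 < q" | "r \<noteq> 0" "r + 1 = q" using r by linarith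
  thus ?thesis
  proof cases
    case 1
    thus ?thesis using s assms by (simp add: admissible_step_def alpha_MER_def flip: r_def)
  next
    case 2
    hence a: "alpha_MER q (k + 1) = 2 / (real r + 2)" "alpha_MER q k = 2 / (real r + 1)"
      using s by (simp_all add: alpha_MER_def r_def add.commute)
    have "real r \<ge> 1" using 2 by simp
    thus ?thesis
      unfolding admissible_step_def s a using 2
      by (intro conjI; (rule disjI2, rule disjI1)?)
        (auto simp: divide_simps simp flip: r_def, simp_all add: algebra_simps)
  next
    case 3
    hence a: "alpha_MER q (k + 1) = 2" "alpha_MER q k = 2 / (real r + 1)"
      using s by (simp_all add: alpha_MER_def r_def)
    have q: "real q = real r + 1" and "real r \<ge> 1" using 3 by auto
    have "2 * (real r + 1) \<le> (real r + 1) * (real r + 1)"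
      using \<open>real r \<ge> 1\<close> by (intro mult_right_mono) auto
    moreover have "4 \<le> (real r + 1) * (real r + 1)"
      using mult_mono[of 2 "real r + 1" 2 "real r + 1"] \<open>real r \<ge> 1\<close> by simp
    ultimately have "10 * (real r + 1) + 88 \<le> 27 * ((real r + 1) * (real r + 1))" by linarith
    hence "2 + 88 / (5 * real q) \<le> 27/5 * (real r + 1)"
      unfolding q by (simp add: divide_simps) (simp add: algebra_simps)
    thus ?thesis
      unfolding admissible_step_def s a using 3 \<open>real r \<ge> 1\<close>
      by (intro conjI; (rule disjI2, rule disjI2)?) (auto simp: divide_simps simp flip: r_def)
  qed
qed

text \<open>At a restart index \<open>k\<close> the ceiling for \<open>k\<close> still counts the
  previous epoch, while the one for \<open>k + 1\<close> already counts the new epoch. This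
  off-by-one is the only place where consecutive values of \<open>alpha_MED\<close> differ.\<close>

lemma ceiling_Suc_div:
  assumes "q \<ge> 1"
  shows "\<lceil>real (k + 1) / real q\<rceil> = int (k div q) + 1"
    and "\<lceil>real k / real q\<rceil> = (if k mod q = 0 then int (k div q) else int (k div q) + 1)"
proof -
  define j r where "j = k div q" and "r = k mod q"
  have k: "real k = real j * real q + real r"
    unfolding j_def r_def by (metis div_mult_mod_eq of_nat_add of_nat_mult)
  have r: "real r + 1 \<le> real q"
  proof -
    have "r + 1 \<le> q" using assms mod_less_divisor[of q k] unfolding r_def by linarith
    thus ?thesis using of_nat_mono by fastforce
  qed
  have q: "real q > 0" using assms by simp
  show "\<lceil>real (k + 1) / real q\<rceil> = int (k div q) + 1"
    using r q by (intro ceiling_unique) (auto simp: k field_simps simp flip: j_def)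
  show "\<lceil>real k / real q\<rceil> = (if k mod q = 0 then int (k div q) else int (k div q) + 1)"
    using r q by (cases "r = 0"; intro ceiling_unique) (auto simp: k field_simps simp flip: j_def r_def)
qed

text \<open>With this weight the product with \<open>\<alpha>\<close> is exactly
  \<open>54/5\<close>, and the required decrease reduces to
  \<open>27/5 * j + 22/5 \<le> 27/5 * (j + 1)\<close>. Only the very first iteration, where
  \<open>\<alpha>\<close> drops from 2 to 1, needs the restart alternative.\<close>

lemma alpha_MED_admissible:
  assumes "q \<ge> 1"
  shows "admissible_step q (alpha_MED q) (\<lambda>k. 54/5 / alpha_MED q k) k"
proof -
  define j where "j = real (k div q)"
  have j: "j \<ge> 0" by (simp add: j_def)
  have a1: "alpha_MED q (k + 1) = 2 / (j + 2)"
    unfolding alpha_MED_def ceiling_Suc_div(1)[OF assms] by (simp add: j_def)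
  have a0: "alpha_MED q k = (if k mod q = 0 then 2 / (j + 1) else 2 / (j + 2))"
    unfolding alpha_MED_def ceiling_Suc_div(2)[OF assms] by (simp add: j_def)
  have p: "54/5 / (2 / (j + 2)) = 27/5 * (j + 2)"
    using j by simp
  show ?thesis
  proof (cases "k mod q = 0 \<and> j = 0")
    case True
    thus ?thesis unfolding admissible_step_def p a1 a0 by simp
  next
    case False
    \<comment> \<open>From the second epoch on, the ratio of consecutive values is at most
      \<open>(j + 2) / (j + 1)\<close>, hence at most \<open>3/2\<close>.\<close>
    have j1: "k mod q = 0 \<Longrightarrow> j \<ge> 1"
      using False by (simp add: j_def)
    have 1: "27/5 * (j + 2) * (1 - 2 / (j + 2)) = 27/5 * j"
      "27/5 * (j + 2) * (2 / (j + 2)) = 54/5" "0 < 2 / (j + 2)" "2 / (j + 2) \<le> 1"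
      using j by (simp_all add: field_simps)
    have 2: "alpha_MED q k \<le> 1" "alpha_MED q k \<le> 3/2 * (2 / (j + 2))"
      using j j1 unfolding a0 by (auto simp: divide_simps)
    have 3: "27/5 * (j + 1) \<le> 54/5 / alpha_MED q k"
      using j unfolding a0 by simp
    have "0 \<le> 54/5 / alpha_MED q k" using j unfolding a0 by simp
    thus ?thesis
      unfolding admissible_step_def a1 p 1 using 1 2 3 by (simp add: distrib_left)
  qed
qed

section \<open>The potential\<close>

text \<open>A concave quadratic lies above its chord, so checking the two endpoints suffices; the
  identity in the proof displays the excess over the chord.\<close>

lemma quadratic_chord_nonneg:
  fixes w :: real
  assumes B: "B \<ge> 0" and w: "a \<le> w" "w \<le> b"
    and ga: "0 \<le> A * a - B * a\<^sup>2 - E" and gb: "0 \<le> A * b - B * b\<^sup>2 - E"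
  shows "0 \<le> A * w - B * w\<^sup>2 - E"
proof (cases "a = b")
  case False
  hence ab: "b - a > 0" using w by linarith
  have "(b - a) * (A * w - B * w\<^sup>2 - E) = (b - w) * (A * a - B * a\<^sup>2 - E)
      + (w - a) * (A * b - B * b\<^sup>2 - E) + B * ((w - a) * (b - w) * (b - a))"
    by (simp add: algebra_simps power2_eq_square)
  also have "\<dots> \<ge> 0" using assms by (intro add_nonneg_nonneg mult_nonneg_nonneg) auto
  finally show ?thesis using ab by (simp add: zero_le_mult_iff)
qed (use assms in auto)

text \<open>Here \<open>w = \<lambda>\<^sub>k / \<beta>\<close> and \<open>h = L \<sigma>\<^sub>m\<^sub>a\<^sub>x \<beta>\<close>; the bound \<open>5/34\<close> comes from \<open>34/5 \<le> 3 + sqrt 15\<close>.\<close>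

lemma decrease_budget_inner:
  fixes w h :: real
  assumes "0 \<le> h" "h \<le> 5/34" "1 \<le> w" "w \<le> 2"
  shows "1/20 \<le> w - w\<^sup>2 * h / 2 - w\<^sup>2 / 4 - 22/5 * h\<^sup>2 - 243/10 * h\<^sup>2"
proof -
  have "h\<^sup>2 \<le> (5/34)\<^sup>2" using assms by (intro power_mono)
  hence h2: "h\<^sup>2 \<le> 25/1156" by (simp add: power2_eq_square)
  have "w\<^sup>2 * h \<le> 5/34 * w\<^sup>2"
    using assms mult_left_mono[of h "5/34" "w\<^sup>2"] by (simp add: mult.commute)
  \<comment> \<open>\<open>287/10\<close> is \<open>22/5 + 243/10\<close>, the total weight of
    \<open>h\<^sup>2\<close>, and \<open>1/20\<close> is the margin to be kept.\<close>
  moreover have "0 \<le> 1 * w - (5/68 + 1/4) * w\<^sup>2 - (1/20 + 287/10 * (25/1156))"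
    by (rule quadratic_chord_nonneg[where a = 1 and b = 2]) (use assms in \<open>auto simp: power2_eq_square\<close>)
  \<comment> \<open>Naming the nonlinear terms leaves a purely linear problem.\<close>
  moreover have "1/20 \<le> w - X / 2 - W / 4 - 22/5 * H - 243/10 * H"
    if "X \<le> 5/34 * W" "0 \<le> 1 * w - (5/68 + 1/4) * W - (1/20 + 287/10 * (25/1156))" "H \<le> 25/1156"
    for X W H :: real
    using that by simp
  ultimately show ?thesis using h2 by blast
qed

text \<open>The range extends to 3 because \<open>\<alpha> k\<close> may be 2 at a restart. In
  exchange there is no \<open>w\<^sup>2 / 4\<close>: an exact gradient at \<open>x\<close> causes no
  cross term to be split.\<close>

lemma decrease_budget_restart:
  fixes w h :: real
  assumes "0 \<le> h" "h \<le> 5/34" "1 \<le> w" "w \<le> 3"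
  shows "1/20 \<le> w - w\<^sup>2 * h / 2 - 22/5 * h\<^sup>2 - 54/5 * ((w - 1)\<^sup>2 * h\<^sup>2)"
proof -
  have "h\<^sup>2 \<le> (5/34)\<^sup>2" using assms by (intro power_mono)
  hence h2: "h\<^sup>2 \<le> 25/1156" by (simp add: power2_eq_square)
  have "w\<^sup>2 * h \<le> 5/34 * w\<^sup>2"
    using assms mult_left_mono[of h "5/34" "w\<^sup>2"] by (simp add: mult.commute)
  moreover have "(w - 1)\<^sup>2 * h\<^sup>2 \<le> (w - 1)\<^sup>2 * (25/1156)" using h2 by (intro mult_left_mono) auto
  hence "(w - 1)\<^sup>2 * h\<^sup>2 \<le> 25/1156 * w\<^sup>2 - 50/1156 * w + 25/1156"
    by (simp add: power2_diff algebra_simps)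
  moreover have "0 \<le> (1 + 108/5 * (25/1156)) * w - (5/68 + 54/5 * (25/1156)) * w\<^sup>2
      - (1/20 + 54/5 * (25/1156) + 22/5 * (25/1156))"
    by (rule quadratic_chord_nonneg[where a = 1 and b = 3]) (use assms in \<open>auto simp: power2_eq_square\<close>)
  moreover have "1/20 \<le> w - X / 2 - 22/5 * H - 54/5 * Y"
    if "X \<le> 5/34 * W" "Y \<le> 25/1156 * W - 50/1156 * w + 25/1156" "H \<le> 25/1156"
      "0 \<le> (1 + 108/5 * (25/1156)) * w - (5/68 + 54/5 * (25/1156)) * W
        - (1/20 + 54/5 * (25/1156) + 22/5 * (25/1156))"
    for X W H Y :: real
    using that by simp
  ultimately show ?thesis using h2 by blast
qed

text \<open>\<open>f\<close>, \<open>D\<close>, \<open>U\<close>, \<open>V\<close> stand for the expectations of \<open>f x\<^sub>k\<close>, \<open>\<parallel>d\<^sub>k\<parallel>\<^sup>2\<close>, \<open>\<parallel>y\<^sub>k - x\<^sub>k\<parallel>\<^sup>2\<close> and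
  \<open>\<parallel>v\<^sub>k - \<nabla>f z\<^sub>k\<parallel>\<^sup>2\<close>. The remaining length of the epoch multiplies \<open>V\<close>, because an error made now
  persists up to the next restart; \<open>charge\<close> pays for the part of that error which is due to \<open>y\<^sub>k \<noteq> x\<^sub>k\<close>.\<close>

locale potential =
  fixes L \<sigma> \<beta> h :: real and q :: nat and \<alpha> p lam f D U V :: "nat \<Rightarrow> real"
  assumes L: "L > 0" and \<sigma>: "\<sigma> > 0" and \<beta>: "\<beta> > 0" and q: "q \<ge> 1"
    and h_def: "h = L * \<sigma> * \<beta>" and h: "h \<le> 5/34"
    and step: "\<And>k. admissible_step q \<alpha> p k"
    and lam: "\<And>k. \<beta> \<le> lam k" "\<And>k. lam k \<le> (1 + \<alpha> k) * \<beta>"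
    and nonneg: "\<And>k. 0 \<le> D k" "\<And>k. 0 \<le> U k" "\<And>k. 0 \<le> V k"
    and descent: "\<And>k. f (k + 1) \<le> f k - \<beta> / \<sigma> *
      ((lam k / \<beta> - (lam k / \<beta>)\<^sup>2 * h / 2 - (lam k / \<beta>)\<^sup>2 / 4) * D k
        - 2 * \<sigma>\<^sup>2 * V k - 2 * (L * \<sigma>)\<^sup>2 * (1 - \<alpha> (k + 1))\<^sup>2 * U k)"
    and descent_restart: "\<And>k. k mod q = 0 \<Longrightarrow> \<alpha> (k + 1) = 1 \<Longrightarrow>
      f (k + 1) \<le> f k - \<beta> / \<sigma> * ((lam k / \<beta> - (lam k / \<beta>)\<^sup>2 * h / 2) * D k)"
    and U_step: "\<And>k. 0 < \<alpha> (k + 1) \<Longrightarrow> \<alpha> (k + 1) \<le> 1 \<Longrightarrow>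
      U (k + 1) \<le> (1 - \<alpha> (k + 1)) * U k + (lam k - \<beta>)\<^sup>2 / \<alpha> (k + 1) * D k"
    and V_restart: "\<And>k. k mod q = 0 \<Longrightarrow> V k = 0"
    and V_step: "\<And>k. (k + 1) mod q \<noteq> 0 \<Longrightarrow>
      V (k + 1) \<le> V k + L\<^sup>2 / real q * (2 * \<beta>\<^sup>2 * D k + 2 * (\<alpha> (k + 2))\<^sup>2 * U (k + 1))"
    and U_0: "U 0 = 0"
begin

definition rem :: "nat \<Rightarrow> real" where
  "rem k = real q - real (k mod q)"

definition charge :: "nat \<Rightarrow> real" where
  "charge k = (if k mod q = 0 then 0 else 22/5 * (rem k / real q) * (\<alpha> (k + 1))\<^sup>2)"

text \<open>The part \<open>charge k\<close> of the weight of \<open>U k\<close> is withheld because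
  \<open>V_charge\<close> has already spent it on the bound for \<open>V k\<close>.\<close>

definition \<Psi> :: "nat \<Rightarrow> real" where
  "\<Psi> k = \<sigma> / \<beta> * f k + (L * \<sigma>)\<^sup>2 * (p k - charge k) * U k + 11/5 * \<sigma>\<^sup>2 * rem k * V k"

lemma rem_bounds: "1 \<le> rem k" "rem k \<le> real q"
proof -
  have "k mod q + 1 \<le> q" using q mod_less_divisor[of q k] by linarith
  thus "1 \<le> rem k" unfolding rem_def by linarith
qed (simp add: rem_def)

lemma rem_Suc: "(k + 1) mod q \<noteq> 0 \<Longrightarrow> rem (k + 1) = rem k - 1"
  by (auto simp: rem_def mod_Suc split: if_splits)

lemma rem_last: "(k + 1) mod q = 0 \<Longrightarrow> rem k = 1"
proof -
  assume "(k + 1) mod q = 0"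
  hence "Suc (k mod q) = q" using q by (auto simp: mod_Suc split: if_splits)
  thus "rem k = 1" unfolding rem_def by linarith
qed

lemma charge_le:
  assumes "0 < \<alpha> (k + 1)" "\<alpha> (k + 1) \<le> 1"
  shows "charge k \<le> 22/5 * (\<alpha> (k + 1))\<^sup>2"
proof (cases "k mod q = 0")
  case False
  have "22/5 * (rem k / real q) * (\<alpha> (k + 1))\<^sup>2 \<le> 22/5 * 1 * (\<alpha> (k + 1))\<^sup>2"
    using rem_bounds[of k] q by (intro mult_right_mono mult_left_mono) auto
  thus ?thesis using False by (simp add: charge_def)
qed (simp add: charge_def)

text \<open>At the end of an epoch \<open>rem k = 1\<close> keeps \<open>charge k\<close> small although \<open>\<alpha> (k + 1) = 2\<close>.\<close>

lemma charge_le_p: "charge k \<le> p k"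
proof -
  consider (A) "k mod q = 0" "0 \<le> p k"
    | (B) "0 < \<alpha> (k + 1)" "\<alpha> (k + 1) \<le> 1" "p (k + 1) * (1 - \<alpha> (k + 1)) + 22/5 \<le> p k"
    | (C) "\<alpha> (k + 1) = 2" "(k + 1) mod q = 0" "2 + 88 / (5 * real q) \<le> p k" "0 \<le> p k"
    using step[of k] unfolding admissible_step_def by (elim conjE disjE; blast)
  thus ?thesis
  proof cases
    case A
    thus ?thesis by (simp add: charge_def)
  next
    case B
    have "0 \<le> p (k + 1)" using step[of "k + 1"] by (simp add: admissible_step_def)
    hence "0 \<le> p (k + 1) * (1 - \<alpha> (k + 1))" using B by simp
    moreover have "(\<alpha> (k + 1))\<^sup>2 \<le> 1" using B by (simp add: power_le_one)
    ultimately show ?thesis using B charge_le[OF B(1,2)] by linarith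
  next
    case C
    have "charge k \<le> 88 / (5 * real q)"
      using rem_last[OF C(2)] C(1) by (auto simp: charge_def)
    thus ?thesis using C by linarith
  qed
qed

text \<open>Inside an epoch \<open>rem\<close> drops by one per iteration, which releases
  \<open>11/5 * \<sigma>\<^sup>2 * V k\<close>. The descent consumes
  \<open>2 * \<sigma>\<^sup>2 * V k\<close> of this, and one fifth remains as decrease.\<close>

lemma V_charge:
  "11/5 * \<sigma>\<^sup>2 * rem (k + 1) * V (k + 1) \<le> 11/5 * \<sigma>\<^sup>2 * (rem k - 1) * V k
     + 22/5 * h\<^sup>2 * D k + (L * \<sigma>)\<^sup>2 * charge (k + 1) * U (k + 1)"
proof (cases "(k + 1) mod q = 0")
  case True
  hence "V (k + 1) = 0" "rem k = 1" "charge (k + 1) = 0"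
    using V_restart rem_last by (auto simp: charge_def)
  thus ?thesis using nonneg(1)[of k] by simp
next
  case False
  \<comment> \<open>The remaining length never exceeds \<open>q\<close>, so it is offset by the
    factor \<open>1 / q\<close> gained from averaging over the mini-batch.\<close>
  define \<omega> where "\<omega> = rem (k + 1) / real q"
  have \<omega>: "0 \<le> \<omega>" "\<omega> \<le> 1" using rem_bounds[of "k + 1"] q by (auto simp: \<omega>_def)
  have "11/5 * \<sigma>\<^sup>2 * rem (k + 1) * V (k + 1) \<le> 11/5 * \<sigma>\<^sup>2 * rem (k + 1) *
      (V k + L\<^sup>2 / real q * (2 * \<beta>\<^sup>2 * D k + 2 * (\<alpha> (k + 2))\<^sup>2 * U (k + 1)))"
    using V_step[OF False] rem_bounds[of "k + 1"] by (intro mult_left_mono) auto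
  also have "\<dots> = 11/5 * \<sigma>\<^sup>2 * rem (k + 1) * V k + \<omega> * (22/5 * h\<^sup>2 * D k)
      + (L * \<sigma>)\<^sup>2 * (22/5 * \<omega> * (\<alpha> (k + 2))\<^sup>2) * U (k + 1)"
    unfolding \<omega>_def h_def using q by (simp add: field_simps power2_eq_square)
  also have "22/5 * \<omega> * (\<alpha> (k + 2))\<^sup>2 = charge (k + 1)"
    using False by (simp add: charge_def \<omega>_def)
  also have "\<omega> * (22/5 * h\<^sup>2 * D k) \<le> 22/5 * h\<^sup>2 * D k"
    using \<omega> nonneg(1)[of k] by (intro mult_left_le_one_le) auto
  finally show ?thesis using rem_Suc[OF False] by simp
qed

text \<open>All alternatives of \<open>admissible_step\<close> share the accounting in
  \<open>budget\<close>: the coefficient of \<open>D k\<close> must cover the margin and the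
  contribution of \<open>V_charge\<close>, and that of \<open>U k\<close> must fit into
  \<open>p k - charge k\<close>. They differ only in how the gap is controlled.\<close>

lemma \<Psi>_decrease: "\<Psi> (k + 1) \<le> \<Psi> k - D k / 20 - \<sigma>\<^sup>2 * V k / 5"
proof -
  define w where "w = lam k / \<beta>"
  define a where "a = \<alpha> (k + 1)"
  define T where "T = (L * \<sigma>)\<^sup>2"
  have T: "T \<ge> 0" by (simp add: T_def)
  have w1: "1 \<le> w" and w2: "w \<le> 1 + \<alpha> k" using lam[of k] \<beta> by (auto simp: w_def field_simps)
  have h0: "0 \<le> h" using L \<sigma> \<beta> by (simp add: h_def)
  have lamb: "(lam k - \<beta>)\<^sup>2 * T = (w - 1)\<^sup>2 * h\<^sup>2"
    using \<beta> by (simp add: w_def h_def T_def field_simps power2_eq_square)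
  have pos: "\<sigma> / \<beta> > 0" using \<sigma> \<beta> by simp
  have U1: "T * p (k + 1) * U (k + 1) \<le> T * (p (k + 1) * (1 - a)) * U k + p (k + 1) * a * (((w - 1) / a)\<^sup>2 * h\<^sup>2) * D k"
    if a01: "0 < a" "a \<le> 1"
  proof -
    have "0 \<le> p (k + 1)" using step[of "k + 1"] by (simp add: admissible_step_def)
    hence "T * p (k + 1) * U (k + 1) \<le> T * p (k + 1) * ((1 - a) * U k + (lam k - \<beta>)\<^sup>2 / a * D k)"
      using U_step[of k] a01 T by (intro mult_left_mono) (auto simp: a_def)
    also have "\<dots> = T * (p (k + 1) * (1 - a)) * U k + p (k + 1) / a * ((lam k - \<beta>)\<^sup>2 * T) * D k"
      by (simp add: algebra_simps)
    also have "p (k + 1) / a * ((lam k - \<beta>)\<^sup>2 * T) = p (k + 1) * a * (((w - 1) / a)\<^sup>2 * h\<^sup>2)"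
      unfolding lamb using a01 by (simp add: power2_eq_square)
    finally show ?thesis .
  qed
  have descent': "\<sigma> / \<beta> * f (k + 1) \<le> \<sigma> / \<beta> * f k - (w - w\<^sup>2 * h / 2 - w\<^sup>2 / 4) * D k
      + 2 * \<sigma>\<^sup>2 * V k + T * (2 * (1 - a)\<^sup>2) * U k"
  proof -
    have "\<sigma> / \<beta> * f (k + 1) \<le> \<sigma> / \<beta> * (f k - \<beta> / \<sigma> * ((w - w\<^sup>2 * h / 2 - w\<^sup>2 / 4) * D k
        - 2 * \<sigma>\<^sup>2 * V k - 2 * T * (1 - a)\<^sup>2 * U k))"
      using mult_left_mono[OF descent[of k], of "\<sigma> / \<beta>"] pos unfolding w_def T_def a_def by linarith
    also have "\<dots> = \<sigma> / \<beta> * f k - (w - w\<^sup>2 * h / 2 - w\<^sup>2 / 4) * D k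
      + 2 * \<sigma>\<^sup>2 * V k + T * (2 * (1 - a)\<^sup>2) * U k"
      using \<sigma> \<beta> by (simp add: right_diff_distrib)
    finally show ?thesis .
  qed
  have budget: ?thesis if
    *: "\<sigma> / \<beta> * f (k + 1) + T * p (k + 1) * U (k + 1) \<le> \<sigma> / \<beta> * f k - c * D k
      + 2 * \<sigma>\<^sup>2 * V k + T * (p k - charge k) * U k" and c: "1/20 + 22/5 * h\<^sup>2 \<le> c" for c
  proof -
    have "(1/20 + 22/5 * h\<^sup>2) * D k \<le> c * D k"
      using c nonneg(1) by (intro mult_right_mono) auto
    hence 1: "D k / 20 + 22/5 * h\<^sup>2 * D k \<le> c * D k" by (simp add: distrib_right)
    have 2: "11/5 * \<sigma>\<^sup>2 * rem (k + 1) * V (k + 1) \<le> 11/5 * \<sigma>\<^sup>2 * rem k * V k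
        - 11/5 * (\<sigma>\<^sup>2 * V k) + 22/5 * h\<^sup>2 * D k + T * charge (k + 1) * U (k + 1)"
      using V_charge[of k] unfolding T_def right_diff_distrib left_diff_distrib by simp
    have 3: "T * (p (k + 1) - charge (k + 1)) * U (k + 1) =
        T * p (k + 1) * U (k + 1) - T * charge (k + 1) * U (k + 1)"
      by (simp add: algebra_simps)
    show ?thesis
      unfolding \<Psi>_def T_def[symmetric] 3 using * 1 2 by linarith
  qed
  have D: "0 \<le> D k" and U: "0 \<le> T * U k" using nonneg T by auto
  consider (A) "k mod q = 0" "a = 1" "\<alpha> k \<le> 2" "p (k + 1) \<le> 54/5"
    | (B) "0 < a" "a \<le> 1" "\<alpha> k \<le> 1" "\<alpha> k \<le> 3/2 * a"
        "p (k + 1) * a \<le> 54/5" "p (k + 1) * (1 - a) + 22/5 \<le> p k"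
    | (C) "a = 2" "\<alpha> k \<le> 1" "(k + 1) mod q = 0" "p (k + 1) = 0" "2 + 88 / (5 * real q) \<le> p k"
    using step[of k] unfolding admissible_step_def a_def by (elim conjE disjE; blast)
  thus ?thesis
  proof cases
    \<comment> \<open>With \<open>a = 1\<close> the old gap drops out of the bound for
      \<open>U (k + 1)\<close>, so the full weight \<open>54/5\<close> is paid by
      \<open>D k\<close>.\<close>
    case A
    show ?thesis
    proof (rule budget[where c = "w - w\<^sup>2 * h / 2 - 54/5 * ((w - 1)\<^sup>2 * h\<^sup>2)"])
      show "1/20 + 22/5 * h\<^sup>2 \<le> w - w\<^sup>2 * h / 2 - 54/5 * ((w - 1)\<^sup>2 * h\<^sup>2)"
      proof -
        have "w \<le> 3" using w2 A by simp
        from decrease_budget_restart[OF h0 h w1 this] show ?thesis by linarith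
      qed
      have "T * p (k + 1) * U (k + 1) \<le> p (k + 1) * ((w - 1)\<^sup>2 * h\<^sup>2) * D k"
        using U1 A by simp
      also have "\<dots> \<le> 54/5 * ((w - 1)\<^sup>2 * h\<^sup>2) * D k"
        using A D by (intro mult_right_mono) auto
      finally have 1: "T * p (k + 1) * U (k + 1) \<le> 54/5 * ((w - 1)\<^sup>2 * h\<^sup>2) * D k" .
      have "\<sigma> / \<beta> * f (k + 1) \<le> \<sigma> / \<beta> * (f k - \<beta> / \<sigma> * ((w - w\<^sup>2 * h / 2) * D k))"
        using mult_left_mono[OF descent_restart[of k], of "\<sigma> / \<beta>"] A pos unfolding w_def a_def by simp
      also have "\<dots> = \<sigma> / \<beta> * f k - (w - w\<^sup>2 * h / 2) * D k"
        using \<sigma> \<beta> by (simp add: right_diff_distrib)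
      finally have 2: "\<sigma> / \<beta> * f (k + 1) \<le> \<sigma> / \<beta> * f k - (w - w\<^sup>2 * h / 2) * D k" .
      have "0 \<le> T * (p k - charge k) * U k" "0 \<le> 2 * \<sigma>\<^sup>2 * V k"
        using T nonneg charge_le_p[of k] by auto
      with 1 2 show "\<sigma> / \<beta> * f (k + 1) + T * p (k + 1) * U (k + 1) \<le> \<sigma> / \<beta> * f k
          - (w - w\<^sup>2 * h / 2 - 54/5 * ((w - 1)\<^sup>2 * h\<^sup>2)) * D k + 2 * \<sigma>\<^sup>2 * V k + T * (p k - charge k) * U k"
        unfolding left_diff_distrib by linarith
    qed
  next
    case B
    show ?thesis
    proof (rule budget[where c = "w - w\<^sup>2 * h / 2 - w\<^sup>2 / 4 - 243/10 * h\<^sup>2"])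
      show "1/20 + 22/5 * h\<^sup>2 \<le> w - w\<^sup>2 * h / 2 - w\<^sup>2 / 4 - 243/10 * h\<^sup>2"
      proof -
        have "w \<le> 2" using w2 B by simp
        from decrease_budget_inner[OF h0 h w1 this] show ?thesis by linarith
      qed
      \<comment> \<open>The excess \<open>w - 1\<close> is at most \<open>\<alpha> k\<close>, and
        consecutive parameters have ratio at most \<open>3/2\<close>. This is the origin of
        \<open>243/10 = 54/5 * (3/2)\<^sup>2\<close>.\<close>
      have "(w - 1) / a \<le> 3/2" using w2 B by (simp add: divide_le_eq)
      hence "((w - 1) / a)\<^sup>2 \<le> (3/2)\<^sup>2" using w1 B by (intro power_mono) auto
      hence 0: "((w - 1) / a)\<^sup>2 * h\<^sup>2 \<le> (3/2)\<^sup>2 * h\<^sup>2" by (rule mult_right_mono) simp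
      have "p (k + 1) * a * (((w - 1) / a)\<^sup>2 * h\<^sup>2) \<le> 54/5 * ((3/2)\<^sup>2 * h\<^sup>2)"
        by (rule mult_mono[OF B(5) 0]) auto
      hence "p (k + 1) * a * (((w - 1) / a)\<^sup>2 * h\<^sup>2) * D k \<le> 243/10 * h\<^sup>2 * D k"
        using D by (intro mult_right_mono) (auto simp: power2_eq_square)
      with U1[OF B(1,2)] have 1: "T * p (k + 1) * U (k + 1)
          \<le> p (k + 1) * (1 - a) * (T * U k) + 243/10 * h\<^sup>2 * D k"
        by (simp add: mult_ac)
      have "a\<^sup>2 \<le> a" using B(1,2) by (simp add: power2_eq_square mult_left_le)
      moreover have "(1 - a)\<^sup>2 \<le> 1 - a" using B(1,2) by (simp add: power2_eq_square mult_left_le)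
      ultimately have "p (k + 1) * (1 - a) + 2 * (1 - a)\<^sup>2 \<le> p k - charge k"
        using B charge_le[of k] by (simp add: a_def)
      hence "(p (k + 1) * (1 - a) + 2 * (1 - a)\<^sup>2) * (T * U k) \<le> (p k - charge k) * (T * U k)"
        using U by (rule mult_right_mono)
      hence "p (k + 1) * (1 - a) * (T * U k) + T * (2 * (1 - a)\<^sup>2) * U k \<le> T * (p k - charge k) * U k"
        by (simp add: algebra_simps)
      with 1 descent' show "\<sigma> / \<beta> * f (k + 1) + T * p (k + 1) * U (k + 1) \<le> \<sigma> / \<beta> * f k
          - (w - w\<^sup>2 * h / 2 - w\<^sup>2 / 4 - 243/10 * h\<^sup>2) * D k + 2 * \<sigma>\<^sup>2 * V k + T * (p k - charge k) * U k"
        unfolding left_diff_distrib by linarith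
    qed
  next
    \<comment> \<open>No contraction of the gap is available for \<open>a = 2\<close>, but
      \<open>p (k + 1) = 0\<close> removes the next gap from the potential. Only the current gap has
      to be paid: 2 from the descent and \<open>88 / (5 * real q)\<close> from the charge.\<close>
    case C
    show ?thesis
    proof (rule budget[where c = "w - w\<^sup>2 * h / 2 - w\<^sup>2 / 4"])
      have "w \<le> 2" "0 \<le> h\<^sup>2" using w2 C by simp_all
      with decrease_budget_inner[OF h0 h w1]
      show "1/20 + 22/5 * h\<^sup>2 \<le> w - w\<^sup>2 * h / 2 - w\<^sup>2 / 4" by linarith
      have "charge k \<le> 88 / (5 * real q)"
        using rem_last[OF C(3)] C(1) by (auto simp: charge_def a_def)
      hence "2 * (1 - a)\<^sup>2 \<le> p k - charge k" using C by simp
      hence "2 * (1 - a)\<^sup>2 * (T * U k) \<le> (p k - charge k) * (T * U k)"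
        using U by (rule mult_right_mono)
      with descent' C(4) show "\<sigma> / \<beta> * f (k + 1) + T * p (k + 1) * U (k + 1) \<le> \<sigma> / \<beta> * f k
          - (w - w\<^sup>2 * h / 2 - w\<^sup>2 / 4) * D k + 2 * \<sigma>\<^sup>2 * V k + T * (p k - charge k) * U k"
        by (simp add: mult_ac)
    qed
  qed
qed

text \<open>Telescoping. Gap and error vanish at the start; at the end they are discarded, their
  weights being nonnegative by \<open>charge_le_p\<close> and \<open>rem_bounds\<close>.\<close>

lemma potential_sum:
  "(\<Sum>k<K. D k / 20 + \<sigma>\<^sup>2 * V k / 5) \<le> \<sigma> / \<beta> * (f 0 - f K)"
proof -
  have "(\<Sum>k<K. D k / 20 + \<sigma>\<^sup>2 * V k / 5) \<le> \<Psi> 0 - \<Psi> K"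
  proof (induction K)
    case (Suc K)
    thus ?case using \<Psi>_decrease[of K] by simp
  qed simp
  moreover have "\<Psi> 0 = \<sigma> / \<beta> * f 0"
    using U_0 V_restart[of 0] by (simp add: \<Psi>_def)
  moreover have "\<sigma> / \<beta> * f K \<le> \<Psi> K"
    using charge_le_p[of K] rem_bounds(1)[of K] nonneg[of K] by (simp add: \<Psi>_def)
  ultimately show ?thesis by (simp add: right_diff_distrib)
qed

end

section \<open>Trajectories\<close>

text \<open>The pair with index \<open>j\<close> reads index \<open>j + 1\<close>, but all pairs
  used have \<open>j < k\<close>, so nothing beyond \<open>k\<close> is read. This makes the
  quasi-Newton matrix non-anticipating.\<close>

lemma sdlbfgs_cong:
  assumes "\<And>j. j \<le> k \<Longrightarrow> x j = x' j" "\<And>j. j \<le> k \<Longrightarrow> v j = v' j"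
  shows "sdlbfgs d m \<delta> \<gamma>0 x v k = sdlbfgs d m \<delta> \<gamma>0 x' v' k"
proof -
  have s: "sdiff x j = sdiff x' j" "ybar v j = ybar v' j" if "j < k" for j
    using assms that by (auto simp: sdiff_def ybar_def)
  have g: "gam \<delta> \<gamma>0 x v i = gam \<delta> \<gamma>0 x' v' i" if "i \<le> k" for i
    using that s[of "i - 1"] by (cases "i = 0") (auto simp: gam_def)
  have sg: "sig \<delta> \<gamma>0 x v j = sig \<delta> \<gamma>0 x' v' j" if "j < k" for j
    using s[OF that] g[of "j + 1"] that by (simp add: sig_def)
  have t: "theta \<delta> \<gamma>0 x v j = theta \<delta> \<gamma>0 x' v' j" if "j < k" for j
    using s[OF that] sg[OF that] by (simp add: theta_def)
  have yh: "yhat \<delta> \<gamma>0 x v j = yhat \<delta> \<gamma>0 x' v' j" if "j < k" for j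
    using s[OF that] t[OF that] g[of "j + 1"] that by (simp add: yhat_def)
  have r: "rho \<delta> \<gamma>0 x v j = rho \<delta> \<gamma>0 x' v' j" if "j < k" for j
    using s[OF that] yh[OF that] by (simp add: rho_def)
  show ?thesis
    unfolding sdlbfgs_def using s r yh g[of k] by (intro fold_cong) auto
qed

text \<open>Both schedules enter through \<open>admissible_step\<close>, so one analysis serves
  both. The run is prescribed only on the support of \<open>P\<close>, which is why outcomes carry a
  membership condition throughout.\<close>

locale momentum_setting =
  fixes L \<sigma>min \<sigma> b :: real and d n q K m :: nat and F :: "nat \<Rightarrow> real vec \<Rightarrow> real"
    and \<delta> \<gamma>0 :: real and \<alpha> p lam :: "nat \<Rightarrow> real" and x0 :: "real vec"
    and x y z v :: "(nat \<Rightarrow> nat list) \<Rightarrow> nat \<Rightarrow> real vec"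
    and P :: "(nat \<Rightarrow> nat list) pmf" and f :: "real vec \<Rightarrow> real"
    and H :: "(nat \<Rightarrow> nat list) \<Rightarrow> nat \<Rightarrow> real mat"
  assumes L: "L > 0" and \<sigma>min: "\<sigma>min > 0" and \<sigma>: "\<sigma> > 0" and b: "b > 0"
    and n: "n \<ge> 1" and q: "q \<ge> 1"
    and P_def: "P = batch_law n q q K" and f_def: "f = objective n F"
    and H_def: "H = (\<lambda>\<xi> k. sdlbfgs d m \<delta> \<gamma>0 (x \<xi>) (v \<xi>) k)"
    and x0: "x0 \<in> carrier_vec d"
    and step: "\<And>k. admissible_step q \<alpha> p k"
    and lam: "\<And>k. b \<le> lam k" "\<And>k. lam k \<le> (1 + \<alpha> k) * b"
    and run: "\<And>\<xi>. \<xi> \<in> set_pmf P \<Longrightarrow>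
      momentum_run d n F q m \<delta> \<gamma>0 \<alpha> (\<lambda>_. b) lam x0 K \<xi> (x \<xi>) (y \<xi>) (z \<xi>) (v \<xi>)"
    and bdd: "bdd_below (f ` carrier_vec d)"
    and smooth_F: "\<And>i. i \<in> {1..n} \<Longrightarrow> smooth d L (F i)"
    and H_lower: "\<And>\<xi> k. \<xi> \<in> set_pmf P \<Longrightarrow> k < K \<Longrightarrow> loewner_le d (\<sigma>min \<cdot>\<^sub>m 1\<^sub>m d) (H \<xi> k)"
    and H_upper: "\<And>\<xi> k. \<xi> \<in> set_pmf P \<Longrightarrow> k < K \<Longrightarrow> loewner_le d (H \<xi> k) (\<sigma> \<cdot>\<^sub>m 1\<^sub>m d)"
begin

abbreviation "g \<equiv> grad d f"

definition dir :: "(nat \<Rightarrow> nat list) \<Rightarrow> nat \<Rightarrow> real vec" where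
  "dir \<xi> k = H \<xi> k *\<^sub>v v \<xi> k"

definition gap :: "(nat \<Rightarrow> nat list) \<Rightarrow> nat \<Rightarrow> real vec" where
  "gap \<xi> k = y \<xi> k - x \<xi> k"

definition err :: "(nat \<Rightarrow> nat list) \<Rightarrow> nat \<Rightarrow> real vec" where
  "err \<xi> k = v \<xi> k - g (z \<xi> k)"

lemma diff_F: "i \<in> {1..n} \<Longrightarrow> differentiable_everywhere d (F i)"
  using smooth_F by (auto simp: smooth_def)

lemma smooth_f: "smooth d L f"
  unfolding f_def using smooth_objective[OF n smooth_F] L by simp

lemma g_eq: "w \<in> carrier_vec d \<Longrightarrow> g w = mean_grad d n F w"
  unfolding f_def using has_gradient_objective[OF n diff_F] by (intro grad_eqI)

lemma g_carrier [simp]: "w \<in> carrier_vec d \<Longrightarrow> g w \<in> carrier_vec d"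
  by (simp add: g_eq)

lemma finite_P: "finite (set_pmf P)"
  unfolding P_def by (rule batch_law_support(1)[OF n])

lemma run_start:
  assumes "\<xi> \<in> set_pmf P" shows "x \<xi> 0 = x0" "y \<xi> 0 = x0"
  using run[OF assms] by (auto simp: momentum_run_def)

lemma run_step:
  assumes "\<xi> \<in> set_pmf P" "k < K"
  shows "z \<xi> k = (1 - \<alpha> (k + 1)) \<cdot>\<^sub>v y \<xi> k + \<alpha> (k + 1) \<cdot>\<^sub>v x \<xi> k"
    and "k mod q = 0 \<Longrightarrow> v \<xi> k = g (z \<xi> k)"
    and "k mod q \<noteq> 0 \<Longrightarrow>
      v \<xi> k = batch_grad d F (\<xi> k) (z \<xi> k) - batch_grad d F (\<xi> k) (z \<xi> (k - 1)) + v \<xi> (k - 1)"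
    and "x \<xi> (k + 1) = x \<xi> k - lam k \<cdot>\<^sub>v dir \<xi> k"
    and "y \<xi> (k + 1) = z \<xi> k - b \<cdot>\<^sub>v dir \<xi> k"
proof -
  have R: "z \<xi> k = (1 - \<alpha> (k + 1)) \<cdot>\<^sub>v y \<xi> k + \<alpha> (k + 1) \<cdot>\<^sub>v x \<xi> k \<and>
      v \<xi> k = (if k mod q = 0 then g (z \<xi> k)
        else batch_grad d F (\<xi> k) (z \<xi> k) - batch_grad d F (\<xi> k) (z \<xi> (k - 1)) + v \<xi> (k - 1)) \<and>
      x \<xi> (k + 1) = x \<xi> k - lam k \<cdot>\<^sub>v dir \<xi> k \<and> y \<xi> (k + 1) = z \<xi> k - b \<cdot>\<^sub>v dir \<xi> k"
    using run[OF assms(1), unfolded momentum_run_def, THEN conjunct2, THEN conjunct2, THEN spec,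
        THEN mp, OF assms(2)]
    unfolding dir_def unfolding H_def f_def .
  show "z \<xi> k = (1 - \<alpha> (k + 1)) \<cdot>\<^sub>v y \<xi> k + \<alpha> (k + 1) \<cdot>\<^sub>v x \<xi> k"
    and "x \<xi> (k + 1) = x \<xi> k - lam k \<cdot>\<^sub>v dir \<xi> k" and "y \<xi> (k + 1) = z \<xi> k - b \<cdot>\<^sub>v dir \<xi> k"
    by (rule R[THEN conjunct1] R[THEN conjunct2, THEN conjunct2, THEN conjunct1]
        R[THEN conjunct2, THEN conjunct2, THEN conjunct2])+
  have V: "v \<xi> k = (if k mod q = 0 then g (z \<xi> k)
      else batch_grad d F (\<xi> k) (z \<xi> k) - batch_grad d F (\<xi> k) (z \<xi> (k - 1)) + v \<xi> (k - 1))"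
    by (rule R[THEN conjunct2, THEN conjunct1])
  show "v \<xi> k = g (z \<xi> k)" if "k mod q = 0" by (rule V[THEN trans]) (simp only: that if_True if_False simp_thms)
  show "v \<xi> k = batch_grad d F (\<xi> k) (z \<xi> k) - batch_grad d F (\<xi> k) (z \<xi> (k - 1)) + v \<xi> (k - 1)"
    if "k mod q \<noteq> 0" by (rule V[THEN trans]) (simp only: that if_True if_False simp_thms)
qed

lemma H_carrier: "\<xi> \<in> set_pmf P \<Longrightarrow> k < K \<Longrightarrow> H \<xi> k \<in> carrier_mat d d"
  by (rule loewner_le_carrier[OF H_lower])

lemma batch_grad_carrier [simp]: "batch_grad d F I w \<in> carrier_vec d"
  by (simp add: batch_grad_def)

lemma run_carrier:
  assumes \<xi>: "\<xi> \<in> set_pmf P"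
  shows "k \<le> K \<Longrightarrow> x \<xi> k \<in> carrier_vec d \<and> y \<xi> k \<in> carrier_vec d \<and>
    (\<forall>j<k. z \<xi> j \<in> carrier_vec d \<and> v \<xi> j \<in> carrier_vec d)"
proof (induction k)
  case 0
  thus ?case using run_start[OF \<xi>] x0 by simp
next
  case (Suc k)
  hence k: "k < K" and IH: "x \<xi> k \<in> carrier_vec d" "y \<xi> k \<in> carrier_vec d"
    "\<And>j. j < k \<Longrightarrow> z \<xi> j \<in> carrier_vec d \<and> v \<xi> j \<in> carrier_vec d" by auto
  have z: "z \<xi> k \<in> carrier_vec d" using run_step(1)[OF \<xi> k] IH by simp
  have v: "v \<xi> k \<in> carrier_vec d"
  proof (cases "k mod q = 0")
    case False
    hence "k - 1 < k" by (cases k) auto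
    thus ?thesis using run_step(3)[OF \<xi> k False] IH(3)[of "k - 1"] by simp
  qed (use run_step(2)[OF \<xi> k] z in simp)
  have "dir \<xi> k \<in> carrier_vec d"
    unfolding dir_def using H_carrier[OF \<xi> k] v by (rule mult_mat_vec_carrier)
  thus ?case
    using run_step(4,5)[OF \<xi> k] IH z v by (auto simp: less_Suc_eq)
qed

lemma carriers [simp]:
  assumes "\<xi> \<in> set_pmf P"
  shows "k \<le> K \<Longrightarrow> x \<xi> k \<in> carrier_vec d" "k \<le> K \<Longrightarrow> y \<xi> k \<in> carrier_vec d"
    "k < K \<Longrightarrow> z \<xi> k \<in> carrier_vec d" "k < K \<Longrightarrow> v \<xi> k \<in> carrier_vec d"
    "k < K \<Longrightarrow> dir \<xi> k \<in> carrier_vec d" "k \<le> K \<Longrightarrow> gap \<xi> k \<in> carrier_vec d"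
    "k < K \<Longrightarrow> err \<xi> k \<in> carrier_vec d"
proof -
  show "k \<le> K \<Longrightarrow> x \<xi> k \<in> carrier_vec d" "k \<le> K \<Longrightarrow> y \<xi> k \<in> carrier_vec d"
    using run_carrier[OF assms] by auto
  thus "k \<le> K \<Longrightarrow> gap \<xi> k \<in> carrier_vec d" by (simp add: gap_def)
  show z: "k < K \<Longrightarrow> z \<xi> k \<in> carrier_vec d" and v: "k < K \<Longrightarrow> v \<xi> k \<in> carrier_vec d"
    using run_carrier[OF assms, of "Suc k"] by auto
  show "k < K \<Longrightarrow> err \<xi> k \<in> carrier_vec d" using z v by (simp add: err_def)
  show "k < K \<Longrightarrow> dir \<xi> k \<in> carrier_vec d"
    unfolding dir_def using H_carrier[OF assms] v by (intro mult_mat_vec_carrier) auto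
qed

lemma dims:
  assumes "\<xi> \<in> set_pmf P" "k < K"
  shows "dim_vec (x \<xi> k) = d" "dim_vec (y \<xi> k) = d" "dim_vec (z \<xi> k) = d" "dim_vec (v \<xi> k) = d"
    "dim_vec (dir \<xi> k) = d" "dim_vec (gap \<xi> k) = d" "dim_vec (g (z \<xi> k)) = d"
    "dim_vec (x \<xi> (k + 1)) = d" "dim_vec (y \<xi> (k + 1)) = d" "dim_vec (gap \<xi> (k + 1)) = d"
proof -
  have k: "k \<le> K" "k + 1 \<le> K" using assms(2) by simp_all
  show "dim_vec (x \<xi> k) = d" "dim_vec (y \<xi> k) = d" "dim_vec (gap \<xi> k) = d"
    by (rule carriers(1,2,6)[OF assms(1) k(1), THEN carrier_vecD])+
  show "dim_vec (x \<xi> (k + 1)) = d" "dim_vec (y \<xi> (k + 1)) = d" "dim_vec (gap \<xi> (k + 1)) = d"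
    by (rule carriers(1,2,6)[OF assms(1) k(2), THEN carrier_vecD])+
  show "dim_vec (z \<xi> k) = d" "dim_vec (v \<xi> k) = d" "dim_vec (dir \<xi> k) = d"
    by (rule carriers(3-5)[OF assms, THEN carrier_vecD])+
  show "dim_vec (g (z \<xi> k)) = d"
    using g_carrier[OF carriers(3)[OF assms]] by (rule carrier_vecD)
qed

text \<open>The induction carries the whole past, since the quasi-Newton matrix looks back at
  earlier iterates and estimates. The estimate at step \<open>k\<close> uses the batch
  \<open>\<xi> k\<close>, so \<open>z\<close> and \<open>v\<close> are compared only at indices
  below the bound.\<close>

lemma run_adapted:
  assumes \<xi>: "\<xi> \<in> set_pmf P" and \<xi>': "\<xi>' \<in> set_pmf P"
  shows "k \<le> K \<Longrightarrow> (\<And>j. j < k \<Longrightarrow> \<xi> j = \<xi>' j) \<Longrightarrow>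
    (\<forall>j\<le>k. x \<xi> j = x \<xi>' j \<and> y \<xi> j = y \<xi>' j) \<and> (\<forall>j<k. z \<xi> j = z \<xi>' j \<and> v \<xi> j = v \<xi>' j)"
proof (induction k)
  case 0
  thus ?case using run_start[OF \<xi>] run_start[OF \<xi>'] by simp
next
  case (Suc k)
  hence k: "k < K" and IH: "\<And>j. j \<le> k \<Longrightarrow> x \<xi> j = x \<xi>' j \<and> y \<xi> j = y \<xi>' j"
    "\<And>j. j < k \<Longrightarrow> z \<xi> j = z \<xi>' j \<and> v \<xi> j = v \<xi>' j" and eq: "\<xi> k = \<xi>' k" by auto
  have z: "z \<xi> k = z \<xi>' k"
    using run_step(1)[OF \<xi> k] run_step(1)[OF \<xi>' k] IH(1)[of k] by simp
  have v: "v \<xi> k = v \<xi>' k"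
  proof (cases "k mod q = 0")
    case False
    hence "k - 1 < k" by (cases k) auto
    thus ?thesis
      using run_step(3)[OF \<xi> k False] run_step(3)[OF \<xi>' k False] IH(2)[of "k - 1"] eq z by simp
  qed (use run_step(2)[OF \<xi> k] run_step(2)[OF \<xi>' k] z in simp)
  have "H \<xi> k = H \<xi>' k"
    unfolding H_def
  proof (rule sdlbfgs_cong)
    fix j assume "j \<le> k"
    thus "x \<xi> j = x \<xi>' j" "v \<xi> j = v \<xi>' j" using IH v by (auto simp: le_less)
  qed
  hence "dir \<xi> k = dir \<xi>' k" using v by (simp add: dir_def)
  hence "x \<xi> (k + 1) = x \<xi>' (k + 1)" "y \<xi> (k + 1) = y \<xi>' (k + 1)"
    unfolding run_step(4,5)[OF \<xi> k] run_step(4,5)[OF \<xi>' k] using IH z by auto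
  thus ?case using IH z v by (auto simp: less_Suc_eq le_Suc_eq)
qed

section \<open>Pathwise estimates for one iteration\<close>

lemma gap_Suc:
  assumes \<xi>: "\<xi> \<in> set_pmf P" and k: "k < K"
  shows "vnorm (gap \<xi> (k + 1)) \<le> \<bar>1 - \<alpha> (k + 1)\<bar> * vnorm (gap \<xi> k) + (lam k - b) * vnorm (dir \<xi> k)"
proof -
  have c: "dir \<xi> k \<in> carrier_vec d" "gap \<xi> k \<in> carrier_vec d"
    using carriers(5)[OF \<xi> k] carriers(6)[OF \<xi>, of k] k by simp_all
  have "gap \<xi> (k + 1) = (1 - \<alpha> (k + 1)) \<cdot>\<^sub>v gap \<xi> k + (lam k - b) \<cdot>\<^sub>v dir \<xi> k"
    unfolding gap_def[of \<xi> "k + 1"] run_step(4,5)[OF \<xi> k] run_step(1)[OF \<xi> k] gap_def[of \<xi> k]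
    by (rule eq_vecI) (simp_all add: dims[OF \<xi> k] left_diff_distrib right_diff_distrib)
  thus ?thesis
    using vnorm_triangle[of "(1 - \<alpha> (k + 1)) \<cdot>\<^sub>v gap \<xi> k" d "(lam k - b) \<cdot>\<^sub>v dir \<xi> k"] c lam(1)[of k]
    by (simp add: vnorm_smult)
qed

lemma extrapolation_norm:
  assumes \<xi>: "\<xi> \<in> set_pmf P" and k: "k < K"
  shows "vnorm (x \<xi> k - z \<xi> k) = \<bar>1 - \<alpha> (k + 1)\<bar> * vnorm (gap \<xi> k)"
proof -
  have "x \<xi> k - z \<xi> k = (- (1 - \<alpha> (k + 1))) \<cdot>\<^sub>v gap \<xi> k"
    unfolding run_step(1)[OF \<xi> k] gap_def
    by (rule eq_vecI) (simp_all add: dims[OF \<xi> k] left_diff_distrib right_diff_distrib)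
  thus ?thesis by (simp only: vnorm_smult abs_minus_cancel)
qed

text \<open>Written relative to \<open>y \<xi> (k + 1)\<close>, the old query point is offset by
  \<open>b \<cdot>\<^sub>v dir \<xi> k\<close> and the new one by a multiple of the gap; the common
  point cancels.\<close>

lemma query_step_norm:
  assumes \<xi>: "\<xi> \<in> set_pmf P" and k: "k + 1 < K"
  shows "vnorm (z \<xi> (k + 1) - z \<xi> k) \<le> b * vnorm (dir \<xi> k) + \<bar>\<alpha> (k + 2)\<bar> * vnorm (gap \<xi> (k + 1))"
proof -
  have k': "k < K" using k by simp
  have c: "dir \<xi> k \<in> carrier_vec d" "gap \<xi> (k + 1) \<in> carrier_vec d"
    using carriers(5)[OF \<xi> k'] carriers(6)[OF \<xi>, of "k + 1"] k by simp_all
  have y: "z \<xi> k = y \<xi> (k + 1) + b \<cdot>\<^sub>v dir \<xi> k"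
    unfolding run_step(5)[OF \<xi> k'] by (rule eq_vecI) (simp_all add: dims[OF \<xi> k'])
  have z: "z \<xi> (k + 1) = (1 - \<alpha> (k + 2)) \<cdot>\<^sub>v y \<xi> (k + 1) + \<alpha> (k + 2) \<cdot>\<^sub>v x \<xi> (k + 1)"
    using run_step(1)[OF \<xi> k] by (simp add: numeral_2_eq_2)
  have "z \<xi> (k + 1) - z \<xi> k = (- b) \<cdot>\<^sub>v dir \<xi> k + (- \<alpha> (k + 2)) \<cdot>\<^sub>v gap \<xi> (k + 1)"
    unfolding z y gap_def
    by (rule eq_vecI)
      (simp_all add: dims[OF \<xi> k'] dims(8-10)[OF \<xi> k', simplified] left_diff_distrib right_diff_distrib)
  thus ?thesis
    using vnorm_triangle[of "(- b) \<cdot>\<^sub>v dir \<xi> k" d "(- \<alpha> (k + 2)) \<cdot>\<^sub>v gap \<xi> (k + 1)"] c b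
    by (simp add: vnorm_smult)
qed

text \<open>The estimate is made at \<open>z\<close> but descent is needed at \<open>x\<close>, so
  \<open>E\<close> adds the Lipschitz cost of moving between them. The product of \<open>D\<close>
  and \<open>E\<close> is left unsplit because at a restart with \<open>\<alpha> (k + 1) = 1\<close>
  the factor \<open>E\<close> is zero and splitting would waste decrease.\<close>

lemma function_decrease:
  assumes \<xi>: "\<xi> \<in> set_pmf P" and k: "k < K"
  defines "E \<equiv> vnorm (err \<xi> k) + L * (\<bar>1 - \<alpha> (k + 1)\<bar> * vnorm (gap \<xi> k))"
    and "D \<equiv> vnorm (dir \<xi> k)" and "w \<equiv> lam k / b"
  shows "f (x \<xi> (k + 1)) \<le> f (x \<xi> k)
    - b / \<sigma> * ((w - w\<^sup>2 * (L * \<sigma> * b) / 2) * D\<^sup>2 - (w * D) * (\<sigma> * E))"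
proof -
  have cs: "x \<xi> k \<in> carrier_vec d" "z \<xi> k \<in> carrier_vec d" "v \<xi> k \<in> carrier_vec d"
    "dir \<xi> k \<in> carrier_vec d" "g (x \<xi> k) \<in> carrier_vec d" "g (z \<xi> k) \<in> carrier_vec d"
    "err \<xi> k \<in> carrier_vec d"
    using carriers[OF \<xi>, of k] k by simp_all
  have lam0: "lam k > 0" using lam(1)[of k] b by linarith
  have D1: "D\<^sup>2 / \<sigma> \<le> v \<xi> k \<bullet> dir \<xi> k"
    using loewner_le_image_norm[OF H_lower[OF \<xi> k] H_upper[OF \<xi> k] _ \<sigma> cs(3)] \<sigma> \<sigma>min
    by (simp add: D_def dir_def divide_le_eq mult.commute)
  have "vnorm (v \<xi> k - g (x \<xi> k)) \<le> E"
  proof -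
    have e: "v \<xi> k - g (x \<xi> k) = err \<xi> k + (g (z \<xi> k) - g (x \<xi> k))"
      unfolding err_def using cs[THEN carrier_vecD] by (intro eq_vecI) auto
    have "vnorm (g (z \<xi> k) - g (x \<xi> k)) \<le> L * vnorm (z \<xi> k - x \<xi> k)"
      using smooth_f cs by (auto simp: smooth_def)
    also have "vnorm (z \<xi> k - x \<xi> k) = \<bar>1 - \<alpha> (k + 1)\<bar> * vnorm (gap \<xi> k)"
      using vnorm_minus_commute[OF cs(1,2)] extrapolation_norm[OF \<xi> k] by simp
    finally show ?thesis
      unfolding e E_def using vnorm_triangle[of "err \<xi> k" d "g (z \<xi> k) - g (x \<xi> k)"] cs by simp
  qed
  hence "vnorm (v \<xi> k - g (x \<xi> k)) * D \<le> E * D" by (rule mult_right_mono) (simp add: D_def)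
  moreover have "(v \<xi> k - g (x \<xi> k)) \<bullet> dir \<xi> k \<le> vnorm (v \<xi> k - g (x \<xi> k)) * D"
    unfolding D_def using cs by (intro scalar_prod_le_vnorm[of _ d]) auto
  moreover have "(v \<xi> k - g (x \<xi> k)) \<bullet> dir \<xi> k = v \<xi> k \<bullet> dir \<xi> k - g (x \<xi> k) \<bullet> dir \<xi> k"
    using cs by (simp add: minus_scalar_prod_distrib[of _ d])
  ultimately have "D\<^sup>2 / \<sigma> - E * D \<le> g (x \<xi> k) \<bullet> dir \<xi> k" using D1 by linarith
  hence 1: "lam k * (D\<^sup>2 / \<sigma> - E * D) \<le> lam k * (g (x \<xi> k) \<bullet> dir \<xi> k)"
    using lam0 by simp
  have "x \<xi> (k + 1) = x \<xi> k + (- lam k) \<cdot>\<^sub>v dir \<xi> k"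
    unfolding run_step(4)[OF \<xi> k] by (rule eq_vecI) (simp_all add: dims[OF \<xi> k])
  hence "f (x \<xi> (k + 1)) \<le> f (x \<xi> k) + g (x \<xi> k) \<bullet> ((- lam k) \<cdot>\<^sub>v dir \<xi> k)
      + L / 2 * (vnorm ((- lam k) \<cdot>\<^sub>v dir \<xi> k))\<^sup>2"
    using smooth_descent[OF smooth_f cs(1), of "(- lam k) \<cdot>\<^sub>v dir \<xi> k"] cs by simp
  also have "\<dots> = f (x \<xi> k) - lam k * (g (x \<xi> k) \<bullet> dir \<xi> k) + L / 2 * (lam k)\<^sup>2 * D\<^sup>2"
    using cs by (simp add: D_def vnorm_smult power_mult_distrib)
  also have "\<dots> \<le> f (x \<xi> k) - lam k * (D\<^sup>2 / \<sigma> - E * D) + L / 2 * (lam k)\<^sup>2 * D\<^sup>2"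
    using 1 by simp
  also have "lam k = w * b" using b by (simp add: w_def)
  also have "f (x \<xi> k) - w * b * (D\<^sup>2 / \<sigma> - E * D) + L / 2 * (w * b)\<^sup>2 * D\<^sup>2 = f (x \<xi> k)
      - b / \<sigma> * ((w - w\<^sup>2 * (L * \<sigma> * b) / 2) * D\<^sup>2 - (w * D) * (\<sigma> * E))"
    using \<sigma> by (simp add: field_simps power2_eq_square)
  finally show ?thesis .
qed

text \<open>Young's inequality splits the cross term at the price \<open>w\<^sup>2 / 4\<close>;
  squaring the two-part error then produces the factors 2.\<close>

lemma function_decrease_square:
  assumes \<xi>: "\<xi> \<in> set_pmf P" and k: "k < K"
  shows "f (x \<xi> (k + 1)) \<le> f (x \<xi> k) - b / \<sigma> *
      ((lam k / b - (lam k / b)\<^sup>2 * (L * \<sigma> * b) / 2 - (lam k / b)\<^sup>2 / 4) * (vnorm (dir \<xi> k))\<^sup>2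
        - 2 * \<sigma>\<^sup>2 * (vnorm (err \<xi> k))\<^sup>2 - 2 * (L * \<sigma>)\<^sup>2 * (1 - \<alpha> (k + 1))\<^sup>2 * (vnorm (gap \<xi> k))\<^sup>2)"
proof -
  define D e u w where "D = vnorm (dir \<xi> k)" and "e = vnorm (err \<xi> k)"
    and "u = \<bar>1 - \<alpha> (k + 1)\<bar> * vnorm (gap \<xi> k)" and "w = lam k / b"
  have u2: "u\<^sup>2 = (1 - \<alpha> (k + 1))\<^sup>2 * (vnorm (gap \<xi> k))\<^sup>2" by (simp add: u_def power_mult_distrib)
  have "0 \<le> (w * D / 2 - \<sigma> * (e + L * u))\<^sup>2" by simp
  hence "(w * D) * (\<sigma> * (e + L * u)) \<le> w\<^sup>2 / 4 * D\<^sup>2 + \<sigma>\<^sup>2 * (e + L * u)\<^sup>2"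
    by (simp add: power2_eq_square algebra_simps)
  also have "\<sigma>\<^sup>2 * (e + L * u)\<^sup>2 \<le> \<sigma>\<^sup>2 * (2 * e\<^sup>2 + 2 * (L * u)\<^sup>2)"
  proof (rule mult_left_mono)
    have "0 \<le> (e - L * u)\<^sup>2" by simp
    thus "(e + L * u)\<^sup>2 \<le> 2 * e\<^sup>2 + 2 * (L * u)\<^sup>2" by (simp add: power2_eq_square algebra_simps)
  qed simp
  finally have "(w - w\<^sup>2 * (L * \<sigma> * b) / 2 - w\<^sup>2 / 4) * D\<^sup>2 - 2 * \<sigma>\<^sup>2 * e\<^sup>2 - 2 * (L * \<sigma>)\<^sup>2 * u\<^sup>2
      \<le> (w - w\<^sup>2 * (L * \<sigma> * b) / 2) * D\<^sup>2 - (w * D) * (\<sigma> * (e + L * u))"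
    by (simp add: algebra_simps power_mult_distrib)
  hence "b / \<sigma> * ((w - w\<^sup>2 * (L * \<sigma> * b) / 2 - w\<^sup>2 / 4) * D\<^sup>2 - 2 * \<sigma>\<^sup>2 * e\<^sup>2 - 2 * (L * \<sigma>)\<^sup>2 * u\<^sup>2)
      \<le> b / \<sigma> * ((w - w\<^sup>2 * (L * \<sigma> * b) / 2) * D\<^sup>2 - (w * D) * (\<sigma> * (e + L * u)))"
    using b \<sigma> by (intro mult_left_mono) auto
  thus ?thesis
    using function_decrease[OF \<xi> k] u2 unfolding D_def e_def u_def w_def by (simp add: mult.assoc)
qed

lemma err_restart:
  assumes "\<xi> \<in> set_pmf P" "k < K" "k mod q = 0"
  shows "vnorm (err \<xi> k) = 0"
  unfolding err_def run_step(2)[OF assms] minus_cancel_vec[OF g_carrier[OF carriers(3)[OF assms(1,2)]]]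
  by simp

text \<open>Decrease is measured by the direction; the lower bound on \<open>H\<close> converts it
  back to \<open>v\<close>, and \<open>err\<close> accounts for the rest of the gradient.\<close>

lemma gradient_norm_square:
  assumes \<xi>: "\<xi> \<in> set_pmf P" and k: "k < K"
  shows "(vnorm (g (z \<xi> k)))\<^sup>2 \<le> 2 * (vnorm (err \<xi> k))\<^sup>2 + 2 / \<sigma>min\<^sup>2 * (vnorm (dir \<xi> k))\<^sup>2"
proof -
  have c: "v \<xi> k \<in> carrier_vec d" "err \<xi> k \<in> carrier_vec d"
    using carriers(4,7)[OF \<xi> k] .
  have "g (z \<xi> k) = v \<xi> k + (-1) \<cdot>\<^sub>v err \<xi> k"
    unfolding err_def by (rule eq_vecI) (simp_all add: dims[OF \<xi> k])
  hence "vnorm (g (z \<xi> k)) \<le> vnorm (v \<xi> k) + vnorm (err \<xi> k)"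
    using vnorm_triangle[of "v \<xi> k" d "(-1) \<cdot>\<^sub>v err \<xi> k"] c by (simp add: vnorm_smult)
  also have "vnorm (v \<xi> k) \<le> vnorm (dir \<xi> k) / \<sigma>min"
    using loewner_le_norm_lower[OF H_lower[OF \<xi> k] H_upper[OF \<xi> k]] c \<sigma>min
    by (simp add: dir_def le_divide_eq mult.commute)
  finally have "(vnorm (g (z \<xi> k)))\<^sup>2 \<le> (vnorm (dir \<xi> k) / \<sigma>min + vnorm (err \<xi> k))\<^sup>2"
    by (intro power_mono) auto
  also have "\<dots> \<le> 2 * (vnorm (dir \<xi> k) / \<sigma>min)\<^sup>2 + 2 * (vnorm (err \<xi> k))\<^sup>2"
    using sum_squares_bound[of "vnorm (dir \<xi> k) / \<sigma>min" "vnorm (err \<xi> k)"] by (simp add: power2_sum)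
  finally show ?thesis by (simp add: power_divide)
qed

section \<open>Replacing a single mini-batch\<close>

lemma resample_support:
  assumes \<xi>: "\<xi> \<in> set_pmf P" and k: "k < K" "k mod q \<noteq> 0"
    and \<eta>: "\<eta> \<in> set_pmf (replicate_pmf q (pmf_of_set {1..n}))"
  shows "\<xi>(k := \<eta>) \<in> set_pmf P" and "length \<eta> = q" and "set \<eta> \<subseteq> {1..n}"
proof -
  show l: "length \<eta> = q" "set \<eta> \<subseteq> {1..n}" using \<eta> n by (auto simp: set_replicate_pmf)
  show "\<xi>(k := \<eta>) \<in> set_pmf P"
    unfolding P_def batch_law_support(2)[OF n] mem_Collect_eq
  proof
    fix j
    show "if j < K \<and> j mod q \<noteq> 0 then length ((\<xi>(k := \<eta>)) j) = q \<and> set ((\<xi>(k := \<eta>)) j) \<subseteq> {1..n}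
      else (\<xi>(k := \<eta>)) j = []"
      using \<xi>[unfolded P_def batch_law_support(2)[OF n] mem_Collect_eq, rule_format, of j] k l
      by (cases "j = k") (simp_all del: One_nat_def)
  qed
qed

text \<open>By \<open>run_adapted\<close>, redrawing batch \<open>k\<close> affects neither the
  previous error nor the two query points. Only the batch average of the gradient differences
  changes, and its deviation from the full average is added to the old error.\<close>

lemma err_resampled:
  assumes \<xi>: "\<xi> \<in> set_pmf P" and k: "k < K" "k mod q \<noteq> 0"
    and \<eta>: "\<eta> \<in> set_pmf (replicate_pmf q (pmf_of_set {1..n}))"
  defines "G \<equiv> \<lambda>i. grad d (F i) (z \<xi> k) - grad d (F i) (z \<xi> (k - 1))"
  shows "err (\<xi>(k := \<eta>)) k = err \<xi> (k - 1) + (vec d (\<lambda>j. (\<Sum>i\<leftarrow>\<eta>. G i $ j) / real (length \<eta>)) -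
    vec d (\<lambda>j. (\<Sum>i=1..n. G i $ j) / real n))"
proof -
  define \<xi>' where "\<xi>' = \<xi>(k := \<eta>)"
  have \<xi>': "\<xi>' \<in> set_pmf P" and \<eta>n: "set \<eta> \<subseteq> {1..n}"
    using resample_support[OF \<xi> k \<eta>] by (auto simp: \<xi>'_def)
  have k1: "k - 1 < k" "k - 1 < K" using k by (cases k; auto)+
  note A = run_adapted[OF \<xi>' \<xi>, of k]
  have eqs: "x \<xi>' k = x \<xi> k" "y \<xi>' k = y \<xi> k" "z \<xi>' (k - 1) = z \<xi> (k - 1)" "v \<xi>' (k - 1) = v \<xi> (k - 1)"
    using A k k1 by (auto simp: \<xi>'_def)
  have z: "z \<xi>' k = z \<xi> k"
    using run_step(1)[OF \<xi>' k(1)] run_step(1)[OF \<xi> k(1)] eqs by simp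
  have v: "v \<xi>' k = batch_grad d F \<eta> (z \<xi> k) - batch_grad d F \<eta> (z \<xi> (k - 1)) + v \<xi> (k - 1)"
    using run_step(3)[OF \<xi>' k] eqs z by (simp add: \<xi>'_def)
  have zc: "z \<xi> k \<in> carrier_vec d" "z \<xi> (k - 1) \<in> carrier_vec d" "v \<xi> (k - 1) \<in> carrier_vec d"
    using \<xi> k k1 by auto
  have G: "G i $ j = grad d (F i) (z \<xi> k) $ j - grad d (F i) (z \<xi> (k - 1)) $ j"
    if "i \<in> {1..n}" "j < d" for i j
    using grad_carrier[OF diff_F[OF that(1)] zc(2)] that(2) by (simp add: G_def)
  have "err \<xi>' k = (batch_grad d F \<eta> (z \<xi> k) - batch_grad d F \<eta> (z \<xi> (k - 1)) + v \<xi> (k - 1))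
      - mean_grad d n F (z \<xi> k)"
    using zc unfolding err_def z v by (simp add: g_eq)
  also have "\<dots> = (v \<xi> (k - 1) - mean_grad d n F (z \<xi> (k - 1))) +
      (vec d (\<lambda>j. (\<Sum>i\<leftarrow>\<eta>. G i $ j) / real (length \<eta>)) - vec d (\<lambda>j. (\<Sum>i=1..n. G i $ j) / real n))"
    (is "?l = ?r")
  proof (rule eq_vecI)
    fix j assume "j < dim_vec ?r"
    hence j: "j < d" by simp
    have 1: "(\<Sum>i\<leftarrow>\<eta>. G i $ j) = (\<Sum>i\<leftarrow>\<eta>. grad d (F i) (z \<xi> k) $ j) - (\<Sum>i\<leftarrow>\<eta>. grad d (F i) (z \<xi> (k - 1)) $ j)"
      using \<eta>n G j by (subst sum_list_subtractf[symmetric])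
        (intro arg_cong[where f = sum_list] map_cong, auto)
    have 2: "(\<Sum>i=1..n. G i $ j) = (\<Sum>i=1..n. grad d (F i) (z \<xi> k) $ j) - (\<Sum>i=1..n. grad d (F i) (z \<xi> (k - 1)) $ j)"
      using G j by (simp add: sum_subtractf)
    show "?l $ j = ?r $ j"
      using j zc(3) unfolding batch_grad_def mean_grad_def
      by (simp add: 1 2[simplified] diff_divide_distrib)
  qed simp
  also have "v \<xi> (k - 1) - mean_grad d n F (z \<xi> (k - 1)) = err \<xi> (k - 1)"
    using zc by (simp add: err_def g_eq)
  finally show ?thesis unfolding \<xi>'_def .
qed

section \<open>Recursions for the expected quantities\<close>

abbreviation Ex :: "((nat \<Rightarrow> nat list) \<Rightarrow> real) \<Rightarrow> real" where
  "Ex \<equiv> measure_pmf.expectation P"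

lemma Ex_mono: "(\<And>\<xi>. \<xi> \<in> set_pmf P \<Longrightarrow> \<phi> \<xi> \<le> \<psi> \<xi>) \<Longrightarrow> Ex \<phi> \<le> Ex \<psi>"
  by (rule expectation_mono_pmf[OF finite_P])

lemma Ex_integrable [simp]: "integrable (measure_pmf P) (\<phi> :: _ \<Rightarrow> real)"
  by (rule integrable_measure_pmf_finite[OF finite_P])

text \<open>Averaging over a fresh copy of batch \<open>k\<close> with everything else fixed makes
  the new sampling error centred, so the mean squares add without a cross term.\<close>

lemma Ex_err_step:
  assumes k: "k < K" "k mod q \<noteq> 0"
  shows "Ex (\<lambda>\<xi>. (vnorm (err \<xi> k))\<^sup>2) \<le> Ex (\<lambda>\<xi>. (vnorm (err \<xi> (k - 1)))\<^sup>2)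
    + L\<^sup>2 / real q * Ex (\<lambda>\<xi>. (vnorm (z \<xi> k - z \<xi> (k - 1)))\<^sup>2)"
proof -
  let ?r = "replicate_pmf q (pmf_of_set {1..n})"
  have k1: "k - 1 < K" using k by auto
  have "Ex (\<lambda>\<xi>. (vnorm (err \<xi> k))\<^sup>2) =
      Ex (\<lambda>\<xi>. measure_pmf.expectation ?r (\<lambda>\<eta>. (vnorm (err (\<xi>(k := \<eta>)) k))\<^sup>2))"
    unfolding P_def by (rule expectation_batch_law_resample[OF n k])
  also have "\<dots> \<le> Ex (\<lambda>\<xi>. (vnorm (err \<xi> (k - 1)))\<^sup>2 + L\<^sup>2 / real q * (vnorm (z \<xi> k - z \<xi> (k - 1)))\<^sup>2)"
  proof (rule Ex_mono)
    fix \<xi> assume \<xi>: "\<xi> \<in> set_pmf P"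
    define G where "G i = grad d (F i) (z \<xi> k) - grad d (F i) (z \<xi> (k - 1))" for i
    have zc: "z \<xi> k \<in> carrier_vec d" "z \<xi> (k - 1) \<in> carrier_vec d" using \<xi> k k1 by auto
    have "measure_pmf.expectation ?r (\<lambda>\<eta>. (vnorm (err (\<xi>(k := \<eta>)) k))\<^sup>2) =
        measure_pmf.expectation ?r (\<lambda>\<eta>. (vnorm (err \<xi> (k - 1) +
          (vec d (\<lambda>j. (\<Sum>i\<leftarrow>\<eta>. G i $ j) / real (length \<eta>)) - vec d (\<lambda>j. (\<Sum>i=1..n. G i $ j) / real n))))\<^sup>2)"
      unfolding G_def by (rule expectation_cong_pmf) (simp only: err_resampled[OF \<xi> k])
    also have "\<dots> \<le> (vnorm (err \<xi> (k - 1)))\<^sup>2 + (L * vnorm (z \<xi> k - z \<xi> (k - 1)))\<^sup>2 / real q"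
    proof (rule batch_error_variance[OF n q])
      show "err \<xi> (k - 1) \<in> carrier_vec d" using \<xi> k1 by simp
      fix i assume i: "i \<in> {1..n}"
      show "G i \<in> carrier_vec d" using grad_carrier[OF diff_F[OF i]] zc by (simp add: G_def)
      show "vnorm (G i) \<le> L * vnorm (z \<xi> k - z \<xi> (k - 1))"
        using smooth_F[OF i] zc by (simp add: G_def smooth_def)
    qed
    finally show "measure_pmf.expectation ?r (\<lambda>\<eta>. (vnorm (err (\<xi>(k := \<eta>)) k))\<^sup>2) \<le>
        (vnorm (err \<xi> (k - 1)))\<^sup>2 + L\<^sup>2 / real q * (vnorm (z \<xi> k - z \<xi> (k - 1)))\<^sup>2"
      by (simp add: power_mult_distrib)
  qed
  also have "\<dots> = Ex (\<lambda>\<xi>. (vnorm (err \<xi> (k - 1)))\<^sup>2)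
    + L\<^sup>2 / real q * Ex (\<lambda>\<xi>. (vnorm (z \<xi> k - z \<xi> (k - 1)))\<^sup>2)"
    by simp
  finally show ?thesis .
qed

text \<open>The sequences are frozen after the last iteration, so that the potential argument need not
  know about \<open>K\<close>.\<close>

definition fE :: "nat \<Rightarrow> real" where "fE k = Ex (\<lambda>\<xi>. f (x \<xi> (min k K)))"
definition DE :: "nat \<Rightarrow> real" where "DE k = (if k < K then Ex (\<lambda>\<xi>. (vnorm (dir \<xi> k))\<^sup>2) else 0)"
definition UE :: "nat \<Rightarrow> real" where "UE k = (if k \<le> K then Ex (\<lambda>\<xi>. (vnorm (gap \<xi> k))\<^sup>2) else 0)"
definition VE :: "nat \<Rightarrow> real" where "VE k = (if k < K then Ex (\<lambda>\<xi>. (vnorm (err \<xi> k))\<^sup>2) else 0)"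

lemma UE_step:
  assumes a: "0 < \<alpha> (k + 1)" "\<alpha> (k + 1) \<le> 1"
  shows "UE (k + 1) \<le> (1 - \<alpha> (k + 1)) * UE k + (lam k - b)\<^sup>2 / \<alpha> (k + 1) * DE k"
proof (cases "k < K")
  case True
  define a t where "a = \<alpha> (k + 1)" and "t = lam k - b"
  have t: "t \<ge> 0" using lam(1)[of k] by (simp add: t_def)
  have "Ex (\<lambda>\<xi>. (vnorm (gap \<xi> (k + 1)))\<^sup>2) \<le>
      Ex (\<lambda>\<xi>. (1 - a) * (vnorm (gap \<xi> k))\<^sup>2 + t\<^sup>2 / a * (vnorm (dir \<xi> k))\<^sup>2)"
  proof (rule Ex_mono)
    fix \<xi> assume \<xi>: "\<xi> \<in> set_pmf P"
    define X Y where "X = vnorm (gap \<xi> k)" and "Y = vnorm (dir \<xi> k)"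
    have "vnorm (gap \<xi> (k + 1)) \<le> (1 - a) * X + t * Y"
      using gap_Suc[OF \<xi> True] a unfolding X_def Y_def t_def a_def by simp
    hence "(vnorm (gap \<xi> (k + 1)))\<^sup>2 \<le> ((1 - a) * X + t * Y)\<^sup>2"
      by (intro power_mono) auto
    \<comment> \<open>Convexity of the square with weights \<open>1 - a\<close> and
      \<open>a\<close>, applied to \<open>X\<close> and \<open>t / a * Y\<close>; the subtracted
      term is the exact Jensen gap.\<close>
    also have "\<dots> = (1 - a) * X\<^sup>2 + t\<^sup>2 / a * Y\<^sup>2 - (1 - a) * a * (X - t / a * Y)\<^sup>2"
      using a unfolding a_def[symmetric] by (simp add: field_simps power2_eq_square)
    also have "\<dots> \<le> (1 - a) * X\<^sup>2 + t\<^sup>2 / a * Y\<^sup>2"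
      using a unfolding a_def[symmetric] by simp
    finally show "(vnorm (gap \<xi> (k + 1)))\<^sup>2 \<le> (1 - a) * (vnorm (gap \<xi> k))\<^sup>2 + t\<^sup>2 / a * (vnorm (dir \<xi> k))\<^sup>2"
      by (simp add: X_def Y_def)
  qed
  thus ?thesis using True by (simp add: UE_def DE_def a_def t_def)
next
  case False
  have "0 \<le> UE k" by (simp add: UE_def)
  thus ?thesis using False a by (simp add: UE_def DE_def)
qed

lemma VE_step:
  assumes r: "(k + 1) mod q \<noteq> 0"
  shows "VE (k + 1) \<le> VE k + L\<^sup>2 / real q * (2 * b\<^sup>2 * DE k + 2 * (\<alpha> (k + 2))\<^sup>2 * UE (k + 1))"
proof (cases "k + 1 < K")
  case True
  have "Ex (\<lambda>\<xi>. (vnorm (z \<xi> (k + 1) - z \<xi> k))\<^sup>2) \<le>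
      Ex (\<lambda>\<xi>. 2 * b\<^sup>2 * (vnorm (dir \<xi> k))\<^sup>2 + 2 * (\<alpha> (k + 2))\<^sup>2 * (vnorm (gap \<xi> (k + 1)))\<^sup>2)"
  proof (rule Ex_mono)
    fix \<xi> assume \<xi>: "\<xi> \<in> set_pmf P"
    define X Y where "X = b * vnorm (dir \<xi> k)" and "Y = \<bar>\<alpha> (k + 2)\<bar> * vnorm (gap \<xi> (k + 1))"
    have "(vnorm (z \<xi> (k + 1) - z \<xi> k))\<^sup>2 \<le> (X + Y)\<^sup>2"
      using query_step_norm[OF \<xi> True] unfolding X_def Y_def by (intro power_mono) auto
    also have "\<dots> \<le> 2 * X\<^sup>2 + 2 * Y\<^sup>2"
      using sum_squares_bound[of X Y] by (simp add: power2_sum)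
    finally show "(vnorm (z \<xi> (k + 1) - z \<xi> k))\<^sup>2 \<le>
        2 * b\<^sup>2 * (vnorm (dir \<xi> k))\<^sup>2 + 2 * (\<alpha> (k + 2))\<^sup>2 * (vnorm (gap \<xi> (k + 1)))\<^sup>2"
      by (simp add: X_def Y_def power_mult_distrib)
  qed
  also have "\<dots> = 2 * b\<^sup>2 * DE k + 2 * (\<alpha> (k + 2))\<^sup>2 * UE (k + 1)"
    using True by (simp add: DE_def UE_def)
  finally have "L\<^sup>2 / real q * Ex (\<lambda>\<xi>. (vnorm (z \<xi> (k + 1) - z \<xi> k))\<^sup>2) \<le>
      L\<^sup>2 / real q * (2 * b\<^sup>2 * DE k + 2 * (\<alpha> (k + 2))\<^sup>2 * UE (k + 1))"
    by (rule mult_left_mono) simp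
  thus ?thesis
    using Ex_err_step[OF True r] True by (simp add: VE_def)
next
  case False
  have "0 \<le> VE k" "0 \<le> UE (k + 1)" "0 \<le> DE k" by (auto simp: VE_def UE_def DE_def)
  hence "0 \<le> VE k + L\<^sup>2 / real q * (2 * b\<^sup>2 * DE k + 2 * (\<alpha> (k + 2))\<^sup>2 * UE (k + 1))" by simp
  thus ?thesis using False by (simp add: VE_def)
qed

lemma fE_step:
  "fE (k + 1) \<le> fE k - b / \<sigma> *
      ((lam k / b - (lam k / b)\<^sup>2 * (L * \<sigma> * b) / 2 - (lam k / b)\<^sup>2 / 4) * DE k
        - 2 * \<sigma>\<^sup>2 * VE k - 2 * (L * \<sigma>)\<^sup>2 * (1 - \<alpha> (k + 1))\<^sup>2 * UE k)"
proof (cases "k < K")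
  case True
  have "fE (k + 1) \<le> Ex (\<lambda>\<xi>. f (x \<xi> k) - b / \<sigma> *
      ((lam k / b - (lam k / b)\<^sup>2 * (L * \<sigma> * b) / 2 - (lam k / b)\<^sup>2 / 4) * (vnorm (dir \<xi> k))\<^sup>2
        - 2 * \<sigma>\<^sup>2 * (vnorm (err \<xi> k))\<^sup>2 - 2 * (L * \<sigma>)\<^sup>2 * (1 - \<alpha> (k + 1))\<^sup>2 * (vnorm (gap \<xi> k))\<^sup>2))"
    using True function_decrease_square[of _ k] unfolding fE_def
    by (intro Ex_mono) (simp add: min_absorb1)
  also have "\<dots> = fE k - b / \<sigma> *
      ((lam k / b - (lam k / b)\<^sup>2 * (L * \<sigma> * b) / 2 - (lam k / b)\<^sup>2 / 4) * DE k
        - 2 * \<sigma>\<^sup>2 * VE k - 2 * (L * \<sigma>)\<^sup>2 * (1 - \<alpha> (k + 1))\<^sup>2 * UE k)"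
    using True by (simp add: fE_def DE_def VE_def UE_def min_absorb1)
  finally show ?thesis .
next
  \<comment> \<open>Beyond the last iteration only the gap term can survive, namely at
    \<open>k = K\<close>, and its sign is favourable.\<close>
  case False
  have "0 \<le> UE k" by (simp add: UE_def)
  hence "0 \<le> b / \<sigma> * (2 * (L * \<sigma>)\<^sup>2 * (1 - \<alpha> (k + 1))\<^sup>2 * UE k)"
    using b \<sigma> by (intro mult_nonneg_nonneg) auto
  thus ?thesis using False by (simp add: fE_def DE_def VE_def)
qed

lemma fE_restart:
  assumes r: "k mod q = 0" and a: "\<alpha> (k + 1) = 1"
  shows "fE (k + 1) \<le> fE k - b / \<sigma> * ((lam k / b - (lam k / b)\<^sup>2 * (L * \<sigma> * b) / 2) * DE k)"
proof (cases "k < K")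
  case True
  have "fE (k + 1) \<le> Ex (\<lambda>\<xi>. f (x \<xi> k) - b / \<sigma> *
      ((lam k / b - (lam k / b)\<^sup>2 * (L * \<sigma> * b) / 2) * (vnorm (dir \<xi> k))\<^sup>2))"
    unfolding fE_def
  proof (rule Ex_mono)
    fix \<xi> assume \<xi>: "\<xi> \<in> set_pmf P"
    show "f (x \<xi> (min (k + 1) K)) \<le> f (x \<xi> k) - b / \<sigma> *
      ((lam k / b - (lam k / b)\<^sup>2 * (L * \<sigma> * b) / 2) * (vnorm (dir \<xi> k))\<^sup>2)"
      using function_decrease[OF \<xi> True] err_restart[OF \<xi> True r] a True by (simp add: min_absorb1)
  qed
  also have "\<dots> = fE k - b / \<sigma> * ((lam k / b - (lam k / b)\<^sup>2 * (L * \<sigma> * b) / 2) * DE k)"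
    using True by (simp add: fE_def DE_def min_absorb1)
  finally show ?thesis .
qed (simp add: fE_def DE_def)

lemma sum_DE_VE:
  assumes h_le: "L * \<sigma> * b \<le> 5/34"
  shows "(\<Sum>k<K. DE k / 20 + \<sigma>\<^sup>2 * VE k / 5) \<le> \<sigma> / b * (f x0 - optimal_value d f)"
proof -
  interpret potential L \<sigma> b "L * \<sigma> * b" q \<alpha> p lam fE DE UE VE
  proof
    show "VE k = 0" if "k mod q = 0" for k
    proof -
      have "Ex (\<lambda>\<xi>. (vnorm (err \<xi> k))\<^sup>2) = Ex (\<lambda>\<xi>. 0)" if "k < K"
        using err_restart[OF _ that \<open>k mod q = 0\<close>] by (intro expectation_cong_pmf) simp
      thus ?thesis by (simp add: VE_def)
    qed
    have "Ex (\<lambda>\<xi>. (vnorm (gap \<xi> 0))\<^sup>2) = Ex (\<lambda>\<xi>. 0)"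
      using run_start x0 by (intro expectation_cong_pmf) (simp add: gap_def)
    thus "UE 0 = 0" by (simp add: UE_def)
  qed (use L \<sigma> b q h_le step lam UE_step VE_step fE_step fE_restart
      in \<open>auto simp: DE_def[of _] UE_def[of _] VE_def[of _] simp del: One_nat_def\<close>)
  have "fE 0 = Ex (\<lambda>\<xi>. f x0)"
    unfolding fE_def using run_start by (intro expectation_cong_pmf) simp
  hence "fE 0 = f x0" by simp
  moreover have "optimal_value d f \<le> fE K"
  proof -
    have "Ex (\<lambda>\<xi>. optimal_value d f) \<le> fE K"
      unfolding fE_def optimal_value_def using bdd by (intro Ex_mono cINF_lower) auto
    thus ?thesis by simp
  qed
  ultimately have "\<sigma> / b * (fE 0 - fE K) \<le> \<sigma> / b * (f x0 - optimal_value d f)"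
    using \<sigma> b by (intro mult_left_mono) auto
  with potential_sum[of K] show ?thesis by linarith
qed

lemma sum_gradient_square:
  assumes h_le: "L * \<sigma> * b \<le> 5/34"
  shows "(\<Sum>k<K. Ex (\<lambda>\<xi>. (vnorm (g (z \<xi> k)))\<^sup>2)) \<le>
    (10 / \<sigma>\<^sup>2 + 40 / \<sigma>min\<^sup>2) * (\<sigma> / b * (f x0 - optimal_value d f))"
proof -
  have "Ex (\<lambda>\<xi>. (vnorm (g (z \<xi> k)))\<^sup>2) \<le> (10 / \<sigma>\<^sup>2 + 40 / \<sigma>min\<^sup>2) * (DE k / 20 + \<sigma>\<^sup>2 * VE k / 5)"
    if k: "k < K" for k
  proof -
    have "Ex (\<lambda>\<xi>. (vnorm (g (z \<xi> k)))\<^sup>2) \<le>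
        Ex (\<lambda>\<xi>. 2 * (vnorm (err \<xi> k))\<^sup>2 + 2 / \<sigma>min\<^sup>2 * (vnorm (dir \<xi> k))\<^sup>2)"
      using gradient_norm_square[OF _ k] by (intro Ex_mono)
    also have "\<dots> = 2 * VE k + 2 / \<sigma>min\<^sup>2 * DE k" using k by (simp add: VE_def DE_def)
    \<comment> \<open>The factors 5 and 20 undo the weights in \<open>sum_DE_VE\<close>, whence the
      constants \<open>10 / \<sigma>\<^sup>2\<close> and
      \<open>40 / \<sigma>min\<^sup>2\<close>.\<close>
    also have "\<dots> = 10 / \<sigma>\<^sup>2 * (\<sigma>\<^sup>2 * VE k / 5) + 40 / \<sigma>min\<^sup>2 * (DE k / 20)"
      using \<sigma> by simp
    also have "\<dots> \<le> (10 / \<sigma>\<^sup>2 + 40 / \<sigma>min\<^sup>2) * (\<sigma>\<^sup>2 * VE k / 5) + (10 / \<sigma>\<^sup>2 + 40 / \<sigma>min\<^sup>2) * (DE k / 20)"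
      by (intro add_mono mult_right_mono) (auto simp: VE_def DE_def)
    finally show ?thesis by (simp add: distrib_left)
  qed
  hence "(\<Sum>k<K. Ex (\<lambda>\<xi>. (vnorm (g (z \<xi> k)))\<^sup>2)) \<le>
      (10 / \<sigma>\<^sup>2 + 40 / \<sigma>min\<^sup>2) * (\<Sum>k<K. DE k / 20 + \<sigma>\<^sup>2 * VE k / 5)"
    unfolding sum_distrib_left by (intro sum_mono) auto
  also have "\<dots> \<le> (10 / \<sigma>\<^sup>2 + 40 / \<sigma>min\<^sup>2) * (\<sigma> / b * (f x0 - optimal_value d f))"
    using sum_DE_VE[OF h_le] by (intro mult_left_mono) auto
  finally show ?thesis .
qed

text \<open>Jensen passes to the mean square, and the uniform output index turns the sum over
  iterations into an average.\<close>

lemma output_gradient_norm: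
  assumes h_le: "L * \<sigma> * b \<le> 5/34" and K: "K \<ge> 1"
  shows "(measure_pmf.expectation (pair_pmf P (pmf_of_set {..<K})) (\<lambda>(\<xi>, \<zeta>). vnorm (g (z \<xi> \<zeta>))))\<^sup>2
    \<le> (10 / \<sigma>\<^sup>2 + 40 / \<sigma>min\<^sup>2) * (\<sigma> / b * (f x0 - optimal_value d f)) / real K"
proof -
  have ne: "{..<K} \<noteq> {}" using K by (auto simp: lessThan_empty_iff)
  have fin: "finite (set_pmf (pmf_of_set {..<K}))" using ne by simp
  have finp: "finite (set_pmf (pair_pmf P (pmf_of_set {..<K})))" using finite_P fin by simp
  have "(measure_pmf.expectation (pair_pmf P (pmf_of_set {..<K})) (\<lambda>(\<xi>, \<zeta>). vnorm (g (z \<xi> \<zeta>))))\<^sup>2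
      \<le> measure_pmf.expectation (pair_pmf P (pmf_of_set {..<K})) (\<lambda>\<omega>. ((\<lambda>(\<xi>, \<zeta>). vnorm (g (z \<xi> \<zeta>))) \<omega>)\<^sup>2)"
    by (rule expectation_power2_le[OF finp])
  also have "\<dots> = Ex (\<lambda>\<xi>. (\<Sum>k<K. (vnorm (g (z \<xi> k)))\<^sup>2) / real K)"
    using ne by (subst expectation_pair_pmf_finite[OF finite_P fin]) (simp add: integral_pmf_of_set)
  also have "\<dots> = (\<Sum>k<K. Ex (\<lambda>\<xi>. (vnorm (g (z \<xi> k)))\<^sup>2)) / real K"
    by (simp add: Bochner_Integration.integral_sum)
  also have "\<dots> \<le> (10 / \<sigma>\<^sup>2 + 40 / \<sigma>min\<^sup>2) * (\<sigma> / b * (f x0 - optimal_value d f)) / real K"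
    using sum_gradient_square[OF h_le] by (rule divide_right_mono) simp
  finally show ?thesis .
qed

end

section \<open>Counting oracle calls\<close>

lemma rounded_sqrt_bounds:
  assumes n: "n \<ge> 1" and q: "q \<in> {nat \<lfloor>sqrt (real n)\<rfloor>, nat \<lceil>sqrt (real n)\<rceil>}"
  shows "sqrt (real n) / 2 \<le> real q" and "real q \<le> 2 * sqrt (real n)" and "q \<ge> 1"
proof -
  have s: "sqrt (real n) \<ge> 1" using n by simp
  have f: "\<lfloor>sqrt (real n)\<rfloor> \<ge> 1" using s by (simp add: le_floor_iff)
  have "real q = real_of_int \<lfloor>sqrt (real n)\<rfloor> \<or> real q = real_of_int \<lceil>sqrt (real n)\<rceil>"
    using q f s by (auto simp: of_nat_nat)
  moreover have "1 \<le> real_of_int \<lfloor>sqrt (real n)\<rfloor>" using f by linarith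
  ultimately have b: "sqrt (real n) - 1 \<le> real q" "real q \<le> sqrt (real n) + 1" "1 \<le> real q"
    using s by (auto, linarith+)
  show "sqrt (real n) / 2 \<le> real q" using b by linarith
  show "real q \<le> 2 * sqrt (real n)" using b s by linarith
  show "q \<ge> 1" using b(3) by simp
qed

text \<open>Restarts occur at multiples of \<open>q\<close>, the extra one being the initial full
  gradient that costs \<open>n\<close>. The others cost \<open>n / q\<close> per iteration, at most
  \<open>2 * sqrt n\<close>; the two batch evaluations add at most
  \<open>4 * sqrt n\<close>.\<close>

lemma sfo_calls_bound:
  assumes n: "n \<ge> 1" and q: "q \<in> {nat \<lfloor>sqrt (real n)\<rfloor>, nat \<lceil>sqrt (real n)\<rceil>}"
    and \<xi>: "\<xi> \<in> set_pmf (batch_law n q q K)"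
  shows "real (sfo_calls n q \<xi> K) \<le> real n + 6 * sqrt (real n) * real K"
proof -
  note Q = rounded_sqrt_bounds[OF n q]
  define R where "R = {k. k < K \<and> k mod q = 0}"
  have "R \<subseteq> (\<lambda>j. j * q) ` {..K div q}"
  proof
    fix k assume "k \<in> R"
    hence "k = (k div q) * q" "k div q \<le> K div q" by (auto simp: R_def div_le_mono)
    thus "k \<in> (\<lambda>j. j * q) ` {..K div q}" by blast
  qed
  hence "card R \<le> card ((\<lambda>j. j * q) ` {..K div q})" by (intro card_mono) auto
  also have "\<dots> \<le> K div q + 1" using card_image_le[of "{..K div q}" "\<lambda>j. j * q"] by simp
  finally have "real (card R) \<le> real (K div q) + 1" by linarith
  also have "real (K div q) \<le> real K / real q" by (rule of_nat_div_le_of_nat)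
  finally have cR: "real (card R) \<le> real K / real q + 1" by simp
  have "real (sfo_calls n q \<xi> K) \<le> (\<Sum>k<K. (if k mod q = 0 then real n else 0) + 2 * real q)"
    unfolding sfo_calls_def of_nat_sum
  proof (rule sum_mono)
    fix k assume "k \<in> {..<K}"
    thus "real (if k mod q = 0 then n else 2 * length (\<xi> k)) \<le> (if k mod q = 0 then real n else 0) + 2 * real q"
      using \<xi>[unfolded batch_law_support(2)[OF n] mem_Collect_eq, rule_format, of k] by simp
  qed
  also have "\<dots> = real n * real (card R) + 2 * real q * real K"
    by (simp add: sum.distrib sum.If_cases R_def Int_def)
  also have "\<dots> \<le> real n * (real K / real q + 1) + 2 * (2 * sqrt (real n)) * real K"
    using cR Q by (intro add_mono mult_mono mult_left_mono) auto
  also have "real n * (real K / real q + 1) \<le> real n + 2 * sqrt (real n) * real K"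
  proof -
    have "real n = sqrt (real n) * sqrt (real n)" by simp
    also have "\<dots> \<le> sqrt (real n) * (2 * real q)" using Q(1) by (intro mult_left_mono) auto
    finally have "real n / real q \<le> 2 * sqrt (real n)" using Q(3) by (simp add: divide_le_eq mult_ac)
    hence "real n / real q * real K \<le> 2 * sqrt (real n) * real K" by (rule mult_right_mono) simp
    thus ?thesis by (simp add: distrib_left)
  qed
  finally show ?thesis by linarith
qed

section \<open>Step size and final constants\<close>

lemma sqrt_15_bound: "34/5 \<le> 3 + sqrt 15"
proof -
  have "19/5 \<le> sqrt 15" by (rule real_le_rsqrt) (simp add: power2_eq_square)
  thus ?thesis by simp
qed

lemma vnorm_dim_0: "u \<in> carrier_vec 0 \<Longrightarrow> vnorm u = 0"
  by (simp add: vnorm_L2_set)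

lemma momentum_gradient_norm:
  fixes L \<sigma>min \<sigma>max :: real
  defines "b \<equiv> \<sigma>min / ((3 + sqrt 15) * L * \<sigma>max\<^sup>2)"
  assumes pos: "L > 0" "\<sigma>min > 0" "\<sigma>max > 0" and n: "n \<ge> 1" and q: "q \<ge> 1" and K: "K \<ge> 1"
    and \<epsilon>: "\<epsilon> > 0" and x0: "x0 \<in> carrier_vec d"
    and \<alpha>: "\<alpha> = alpha_MER q \<and> q \<ge> 2 \<or> \<alpha> = alpha_MED q"
    and \<beta>: "\<And>k. \<beta> k = b" and lam: "\<And>k. \<beta> k \<le> lam k \<and> lam k \<le> (1 + \<alpha> k) * \<beta> k"
    and P: "P = batch_law n q q K" and f: "f = objective n F"
    and H: "H = (\<lambda>\<xi> k. sdlbfgs d m \<delta> \<gamma>0 (x \<xi>) (v \<xi>) k)"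
    and run: "\<And>\<xi>. \<xi> \<in> set_pmf P \<Longrightarrow>
      momentum_run d n F q m \<delta> \<gamma>0 \<alpha> \<beta> lam x0 K \<xi> (x \<xi>) (y \<xi>) (z \<xi>) (v \<xi>)"
    and bdd: "bdd_below (f ` carrier_vec d)" and smooth: "\<And>i. i \<in> {1..n} \<Longrightarrow> smooth d L (F i)"
    and H_bounds: "\<And>\<xi> k. \<xi> \<in> set_pmf P \<Longrightarrow> k < K \<Longrightarrow>
      loewner_le d (\<sigma>min \<cdot>\<^sub>m 1\<^sub>m d) (H \<xi> k) \<and> loewner_le d (H \<xi> k) (\<sigma>max \<cdot>\<^sub>m 1\<^sub>m d)"
    and K_ge: "(10 / \<sigma>max\<^sup>2 + 40 / \<sigma>min\<^sup>2) * (\<sigma>max / b) * ((f x0 - optimal_value d f) / \<epsilon>\<^sup>2) \<le> real K"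
  shows "measure_pmf.expectation (pair_pmf P (pmf_of_set {..<K}))
    (\<lambda>(\<xi>, \<zeta>). vnorm (grad d f (z \<xi> \<zeta>))) \<le> \<epsilon>"
proof -
  have c: "3 + sqrt 15 > 0" using sqrt_15_bound by linarith
  have b: "b > 0" unfolding b_def using pos c by simp
  have \<beta>': "\<beta> = (\<lambda>_. b)" using \<beta> by blast
  obtain p where p: "\<And>k. admissible_step q \<alpha> p k"
    using \<alpha> alpha_MER_admissible alpha_MED_admissible[OF q] by metis
  interpret momentum_setting L \<sigma>min \<sigma>max b d n q K m F \<delta> \<gamma>0 \<alpha> p lam x0 x y z v P f H
    by unfold_locales
      (use pos b n q P f H x0 p lam[unfolded \<beta>'] run[unfolded \<beta>'] bdd smooth H_bounds in blast)+
  show ?thesis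
  \<comment> \<open>In dimension zero the Loewner bounds do not order \<open>\<sigma>min\<close> and
    \<open>\<sigma>max\<close>, so the step size cannot be bounded; but every gradient has norm zero
    there.\<close>
  proof (cases "d = 0")
    case True
    have ne: "{..<K} \<noteq> {}" using K by (auto simp: lessThan_empty_iff)
    have "measure_pmf.expectation (pair_pmf P (pmf_of_set {..<K})) (\<lambda>(\<xi>, \<zeta>). vnorm (g (z \<xi> \<zeta>))) =
        measure_pmf.expectation (pair_pmf P (pmf_of_set {..<K})) (\<lambda>_. 0)"
    proof (rule expectation_cong_pmf)
      fix \<omega> assume "\<omega> \<in> set_pmf (pair_pmf P (pmf_of_set {..<K}))"
      then obtain \<xi> k where "\<omega> = (\<xi>, k)" "\<xi> \<in> set_pmf P" "k < K"
        using ne by auto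
      thus "(case \<omega> of (\<xi>, \<zeta>) \<Rightarrow> vnorm (g (z \<xi> \<zeta>))) = 0"
        using vnorm_dim_0[of "g (z \<xi> k)"] g_carrier[OF carriers(3)[of \<xi> k]] True by simp
    qed
    thus ?thesis using \<epsilon> by simp
  next
    case False
    obtain \<xi> where "\<xi> \<in> set_pmf P" using set_pmf_not_empty by fast
    hence le: "\<sigma>min \<le> \<sigma>max"
      using loewner_le_scalars[of d \<sigma>min "H \<xi> 0" \<sigma>max] H_bounds[of \<xi> 0] K False by simp
    have "L * \<sigma>max * b = \<sigma>min / ((3 + sqrt 15) * \<sigma>max)"
      unfolding b_def using pos by (simp add: power2_eq_square)
    also have "\<dots> \<le> 1 / (3 + sqrt 15)" using le pos c by (simp add: divide_simps)
    also have "\<dots> \<le> 5/34" using sqrt_15_bound by (simp add: divide_simps)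
    finally have h: "L * \<sigma>max * b \<le> 5/34" .
    let ?G = "measure_pmf.expectation (pair_pmf P (pmf_of_set {..<K})) (\<lambda>(\<xi>, \<zeta>). vnorm (g (z \<xi> \<zeta>)))"
    define A where "A = (10 / \<sigma>max\<^sup>2 + 40 / \<sigma>min\<^sup>2) * (\<sigma>max / b * (f x0 - optimal_value d f))"
    have "A / \<epsilon>\<^sup>2 \<le> real K" using K_ge by (simp add: A_def mult.assoc)
    hence "A / real K \<le> \<epsilon>\<^sup>2" using \<epsilon> K by (simp add: divide_le_eq mult.commute)
    hence "?G\<^sup>2 \<le> \<epsilon>\<^sup>2" using output_gradient_norm[OF h K, folded A_def] by linarith
    thus ?thesis by (rule power2_le_imp_le) (use \<epsilon> in simp)
  qed
qed

lemma optimal_value_le: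
  "bdd_below (f ` carrier_vec d) \<Longrightarrow> u \<in> carrier_vec d \<Longrightarrow> optimal_value d f \<le> f u"
  unfolding optimal_value_def by (rule cINF_lower)

text \<open>The \<open>+ 1\<close> in the bound on \<open>K\<close> leaves room for rounding to an
  integer. It costs \<open>6 * sqrt n\<close> calls, absorbed together with the initial gradient in
  \<open>7 * n\<close>.\<close>

lemma sfo_calls_order:
  assumes n: "n \<ge> 1" and q: "q \<in> {nat \<lfloor>sqrt (real n)\<rfloor>, nat \<lceil>sqrt (real n)\<rceil>}"
    and \<xi>: "\<xi> \<in> set_pmf (batch_law n q q K)" and "\<Delta> \<ge> 0" "B \<ge> 0"
    and K: "real K \<le> B * (\<Delta> / \<epsilon>\<^sup>2) + 1"
  shows "real (sfo_calls n q \<xi> K) \<le> (7 + 6 * B * \<Delta>) * (real n + sqrt (real n) / \<epsilon>\<^sup>2)"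
proof -
  define s where "s = sqrt (real n)"
  have s: "s \<ge> 1" "real n = s * s" using n by (simp_all add: s_def)
  have "real (sfo_calls n q \<xi> K) \<le> real n + 6 * s * real K"
    unfolding s_def by (rule sfo_calls_bound[OF n q \<xi>])
  also have "\<dots> \<le> real n + 6 * s * (B * (\<Delta> / \<epsilon>\<^sup>2) + 1)"
    using K s by (intro add_left_mono mult_left_mono) auto
  also have "\<dots> = real n + 6 * s + 6 * B * \<Delta> * (s / \<epsilon>\<^sup>2)" by (simp add: algebra_simps)
  also have "\<dots> \<le> real n + 6 * real n + 6 * B * \<Delta> * (s / \<epsilon>\<^sup>2)"
    using mult_left_mono[of 1 s s] s by simp
  also have "\<dots> \<le> (7 + 6 * B * \<Delta>) * (real n + s / \<epsilon>\<^sup>2)"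
  proof -
    define X Y where "X = s / \<epsilon>\<^sup>2" and "Y = 6 * B * \<Delta>"
    have "0 \<le> 7 * X" "0 \<le> Y * real n" using s assms by (auto simp: X_def Y_def)
    thus ?thesis unfolding X_def[symmetric] Y_def[symmetric] by (simp add: distrib_left distrib_right)
  qed
  finally show ?thesis by (simp add: s_def)
qed

text \<open>\<open>C\<close> is chosen before dimension, sample size and accuracy, so it can depend
  only on \<open>L\<close>, \<open>\<sigma>min\<close> and \<open>\<sigma>max\<close>. The parameter
  \<open>B\<close> makes "of this order" precise: with \<open>B \<ge> C\<close> and the added 1, an
  integer \<open>K\<close> in the allowed range always exists. The hidden constant of the oracle
  count is \<open>M\<close>, which sees only the initial suboptimality.\<close>

theorem theorem3:
  fixes L \<sigma>min \<sigma>max :: real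
  assumes "L > 0" and "\<sigma>min > 0" and "\<sigma>max > 0"
  shows "\<exists>C>0. \<forall>B\<ge>C. \<exists>M :: real \<Rightarrow> real.
    \<forall>(d::nat) (n::nat) (q::nat) (K::nat) (F :: nat \<Rightarrow> real vec \<Rightarrow> real) (\<kappa>::real)
      (m::nat) (\<delta>::real) (\<gamma>0::real) (\<alpha> :: nat \<Rightarrow> real) (\<beta> :: nat \<Rightarrow> real) (lam :: nat \<Rightarrow> real)
      (x0 :: real vec) (\<epsilon>::real)
      (x :: (nat \<Rightarrow> nat list) \<Rightarrow> nat \<Rightarrow> real vec) (y :: (nat \<Rightarrow> nat list) \<Rightarrow> nat \<Rightarrow> real vec)
      (z :: (nat \<Rightarrow> nat list) \<Rightarrow> nat \<Rightarrow> real vec) (v :: (nat \<Rightarrow> nat list) \<Rightarrow> nat \<Rightarrow> real vec).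
    (let f = objective n F;
         \<Delta> = f x0 - optimal_value d f;
         P = batch_law n q q K;
         H = (\<lambda>\<xi> k. sdlbfgs d m \<delta> \<gamma>0 (x \<xi>) (v \<xi>) k)
     in
      n \<ge> 1 \<and> K \<ge> 1 \<and> \<epsilon> > 0 \<and> \<delta> > 0 \<and> \<gamma>0 > 0 \<and> x0 \<in> carrier_vec d \<and>
      \<comment> \<open>the square root of n, rounded down or up\<close>
      q \<in> {nat \<lfloor>sqrt (real n)\<rfloor>, nat \<lceil>sqrt (real n)\<rceil>} \<and>
      (\<alpha> = alpha_MER q \<and> q \<ge> 2 \<or> \<alpha> = alpha_MED q) \<and>
      (\<forall>k. \<beta> k = \<sigma>min / ((3 + sqrt 15) * L * \<sigma>max\<^sup>2)) \<and>
      (\<forall>k. \<beta> k \<le> lam k \<and> lam k \<le> (1 + \<alpha> k) * \<beta> k) \<and>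
      (\<forall>\<xi>\<in>set_pmf P. momentum_run d n F q m \<delta> \<gamma>0 \<alpha> \<beta> lam x0 K \<xi> (x \<xi>) (y \<xi>) (z \<xi>) (v \<xi>)) \<and>
      bdd_below (f ` carrier_vec d) \<and>
      (\<forall>i\<in>{1..n}. smooth d L (F i)) \<and>
      \<kappa> > 0 \<and> (\<forall>i\<in>{1..n}. twice_continuously_differentiable d (F i) \<and>
        (\<forall>w\<in>carrier_vec d. spectral_norm d (hessian d (F i) w) \<le> \<kappa>)) \<and>
      (\<forall>\<xi>\<in>set_pmf P. \<forall>k<K. loewner_le d (\<sigma>min \<cdot>\<^sub>m 1\<^sub>m d) (H \<xi> k) \<and>
        loewner_le d (H \<xi> k) (\<sigma>max \<cdot>\<^sub>m 1\<^sub>m d)) \<and>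
      hessian_approx_dependence d K P H v
      \<longrightarrow>
      (real K \<ge> C * (\<Delta> / \<epsilon>\<^sup>2) \<longrightarrow>
         measure_pmf.expectation (pair_pmf P (pmf_of_set {..<K}))
           (\<lambda>(\<xi>, \<zeta>). vnorm (grad d f (z \<xi> \<zeta>))) \<le> \<epsilon> \<and>
         (real K \<le> B * (\<Delta> / \<epsilon>\<^sup>2) + 1 \<longrightarrow>
            (\<forall>\<xi>\<in>set_pmf P. real (sfo_calls n q \<xi> K) \<le> M \<Delta> * (real n + sqrt (real n) / \<epsilon>\<^sup>2)))))"
proof -
  define b where "b = \<sigma>min / ((3 + sqrt 15) * L * \<sigma>max\<^sup>2)"
  define C where "C = (10 / \<sigma>max\<^sup>2 + 40 / \<sigma>min\<^sup>2) * (\<sigma>max / b)"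
  have "b > 0" unfolding b_def using assms sqrt_15_bound by (intro divide_pos_pos mult_pos_pos) auto
  hence C: "C > 0" unfolding C_def using assms by (intro mult_pos_pos add_pos_pos) auto
  show ?thesis
  proof (rule exI[of _ C], rule conjI[OF C], intro allI impI, goal_cases)
    case (1 B)
    show ?case
    proof (rule exI[of _ "\<lambda>\<Delta>. 7 + 6 * B * \<Delta>"], unfold Let_def, intro allI impI, goal_cases)
      case (1 d n q K F \<kappa> m \<delta> \<gamma>0 \<alpha> \<beta> lam x0 \<epsilon> x y z v)
      let ?f = "objective n F" and ?P = "batch_law n q q K"
      let ?H = "\<lambda>\<xi> k. sdlbfgs d m \<delta> \<gamma>0 (x \<xi>) (v \<xi>) k"
      from 1(1) have n: "n \<ge> 1" and K: "K \<ge> 1" and \<epsilon>: "\<epsilon> > 0" and x0: "x0 \<in> carrier_vec d"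
        and q: "q \<in> {nat \<lfloor>sqrt (real n)\<rfloor>, nat \<lceil>sqrt (real n)\<rceil>}"
        and \<alpha>: "\<alpha> = alpha_MER q \<and> q \<ge> 2 \<or> \<alpha> = alpha_MED q"
        and \<beta>: "\<forall>k. \<beta> k = \<sigma>min / ((3 + sqrt 15) * L * \<sigma>max\<^sup>2)"
        and lam: "\<forall>k. \<beta> k \<le> lam k \<and> lam k \<le> (1 + \<alpha> k) * \<beta> k"
        and run: "\<forall>\<xi>\<in>set_pmf ?P. momentum_run d n F q m \<delta> \<gamma>0 \<alpha> \<beta> lam x0 K \<xi> (x \<xi>) (y \<xi>) (z \<xi>) (v \<xi>)"
        and bdd: "bdd_below (?f ` carrier_vec d)" and smooth: "\<forall>i\<in>{1..n}. smooth d L (F i)"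
        and H: "\<forall>\<xi>\<in>set_pmf ?P. \<forall>k<K. loewner_le d (\<sigma>min \<cdot>\<^sub>m 1\<^sub>m d) (?H \<xi> k) \<and>
          loewner_le d (?H \<xi> k) (\<sigma>max \<cdot>\<^sub>m 1\<^sub>m d)"
        by - (elim conjE, assumption)+
      have "measure_pmf.expectation (pair_pmf ?P (pmf_of_set {..<K}))
          (\<lambda>(\<xi>, \<zeta>). vnorm (grad d ?f (z \<xi> \<zeta>))) \<le> \<epsilon>"
        by (rule momentum_gradient_norm[OF assms n rounded_sqrt_bounds(3)[OF n q] K \<epsilon> x0 \<alpha>
              \<beta>[rule_format] lam[rule_format] refl refl refl run[rule_format] bdd smooth[rule_format]
              H[rule_format] 1(2)[unfolded C_def b_def]])
      moreover have "real (sfo_calls n q \<xi> K) \<le>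
          (7 + 6 * B * (?f x0 - optimal_value d ?f)) * (real n + sqrt (real n) / \<epsilon>\<^sup>2)"
        if "\<xi> \<in> set_pmf ?P" "real K \<le> B * ((?f x0 - optimal_value d ?f) / \<epsilon>\<^sup>2) + 1" for \<xi>
      proof (rule sfo_calls_order[OF n q that(1) _ _ that(2)])
        show "0 \<le> ?f x0 - optimal_value d ?f" using optimal_value_le[OF bdd x0] by simp
        show "0 \<le> B" using C \<open>C \<le> B\<close> by simp
      qed
      ultimately show ?case by (intro conjI impI ballI)
    qed
  qed
qed

end
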